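(* Let $n\geq 3$. A physical theory $\mathbb{T}$ admits a post-selection free $n$-cycle paradox if and only if $\mathbb{T}$ contains an extremal vertex of the non-disturbance polytope of the associated $n$-cycle scenario (with binary outcomes).
   Context: **Theory.** A theory $\mathbb{T}$ has systems, states of systems, transformations of systems (including the identity), measurements with classical outcomes, a notion of time ordering operations, and a rule assigning to outcomes of measurements in a given scenario nonnegative normalised probabilities obeying the standard rules of conditional probability. Each measurement $\mathcal{M}_i$ has two models in $\mathbb{T}$, labelled by a setting $s_i\in\{0,1\}$: $s_i=1$ means it is modelled as producing classical records, $s_i=0$ means it is modelled purely as an evolution of systems of $\mathbb{T}$. Nothing more is assumed about these two descriptions (they may coincide). **Multi-agent setup.** A multi-agent setup $\mathcal{MA}$ in $\mathbb{T}$ consists of: a finite set of agents $A_1,\dots,A_N$; a finite set of systems $\mathcal{S}=\{S_1,\dots,S_m\}$; for each $A_i$ a further system $L_i$ (its memory/lab), initialised to a fixed state $\rho^0_{L_i}$, with $\mathcal{L}=\{L_i\}_{i=1}^N$; measurements $\mathcal{M}_1,\dots,\mathcal{M}_N$, where $\mathcal{M}_i$ is performed by $A_i$ at time $t_i$ on some subset of $\mathcal{S}\cup\mathcal{L}\setminus\{L_i\}$, its result being stored in $L_i$, with $t_i<t_j$ for $i<j$; for each $A_i$ a finite set $\mathtt{O}_i$ of values of its outcome; an initial joint state of $S_1,\dots,S_m$ prepared at a time $t_0<t_i$ for all $i$. Measurements are regarded as acting on $\mathcal{S}\cup\mathcal{L}$ by appending identities. **Notation.** A set of outcomes $a_{j_1},\dots,a_{j_p}$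 is written as a vector $\vec{a}_j$, and $\vec{a}_j=\vec{v}_j$ means that the values $\vec{v}_j$ are assigned to it; $\vec{a}_j=\neg\vec{v}_j$ denotes the negation of $\vec{a}_j=\vec{v}_j$. **Default prediction.** A default prediction is a conditional probability $P(\vec{a}_j|\vec{a}_l,\vec{s})$, for outcomes $\vec{a}_j,\vec{a}_l$ of disjoint subsets of measurements ($\vec{a}_j$ non-empty, $\vec{a}_l$ possibly empty), where $\vec{s}=(s_1,\dots,s_N)$ has $s_i=1$ if the outcome of $A_i$ is in $\vec{a}_j\cup\vec{a}_l$ and $s_i=0$ otherwise, computed by the probability rule of $\mathbb{T}$ for the setup and these settings. **Statements.** The set $\Sigma_{\mathcal{MA}}$ consists of: atomic outcome statements $(\vec{a}_j=\vec{v}_j)_{\vec{s}}$ whenever the default prediction satisfies $P(\vec{a}_j=\vec{v}_j|\vec{s})>0$; and atomic inferences $\big((\vec{a}_l=\vec{v}_l)\Rightarrow(\vec{a}_j=\vec{v}_j)\big)_{\vec{s}}$ whenever the default prediction satisfies $P(\vec{a}_j=\vec{v}_j|\vec{a}_l=\vec{v}_l,\vec{s})=1$, or equivalently $P(\vec{a}_j=\neg\vec{v}_j,\vec{a}_l=\vec{v}_l|\vec{s})=0$. The setting-unlabelled version of a statement is obtained by deleting the subscript $\vec{s}$. **Joint measurability.** Measurements $\mathcal{M}_1,\dots,\mathcal{M}_k$ with outcome sets $O_1,\dots,O_k$ on a set of systems are compatible (jointly measurable) if for every initial state $\rho$ there is a measurement with outcome set $O_1\times\dots\times O_k$ whose distribution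 $P(a_1,\dots,a_k|\rho)$ has, for each $i$, marginal on $a_i$ equal to the distribution of $a_i$ when only $\mathcal{M}_i$ is performed on $\rho$. **Compatibility in a setup.** Let $\rho$ be the joint initial state of $\mathcal{S}\cup\mathcal{L}$. A subset $\{\mathcal{M}_{j_1},\dots,\mathcal{M}_{j_p}\}$ of the measurements of $\mathcal{MA}$ (and the corresponding set of agents) is compatible in $\mathcal{MA}$ if there exist measurements $\mathcal{M}'_{j_k}$ on $\mathcal{S}\cup\mathcal{L}$ with the same outcomes $a_{j_k}$, such that (i) the default prediction satisfies $P(a_{j_1},\dots,a_{j_p}|\vec{s})=P(a_{j_1},\dots,a_{j_p}|\rho,\{\mathcal{M}'_{j_k}\}_{k=1}^p)$, the right-hand side being the probability of applying the primed measurements to $\rho$, and the single-outcome marginals of the two sides agree; (ii) the primed measurements are jointly measurable. **Knowledge.** $K_i\phi$ means agent $A_i$ knows $\phi$. Agents reason with the distribution axiom $(K_i\phi\wedge K_i(\phi\Rightarrow\psi))\Rightarrow K_i(\phi\wedge(\phi\Rightarrow\psi))\Rightarrow K_i\psi$. The trust rule is $K_iK_j\phi\Rightarrow K_i\phi$ ($A_i$ trusts $A_j$). **Multi-agent paradox.** The four assumptions are: 1. (common knowledge) All conclusions of agents are based on the common theory $\mathbb{T}$ and the same setup $\mathcal{MA}$, which are common knowledge. 2. (reasoning about compatible agents) Two agents $A,B$ can apply the trust rule to statements $\phi_{\vec{s}}$ of the setup, $K_AK_B\phi_{\vec{s}}\Rightarrow K_A\phi_{\vec{s}}$, only when $A$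 and $B$ are compatible; and agents can only reason using statements $\phi_{\vec{s}}$ of the setup (atomic outcome statements or atomic inferences) such that the set of all outcomes appearing in $\phi_{\vec{s}}$ belongs to a compatible set of measurements. 3. (setting-independence) Every $\phi_{\vec{s}}\in\Sigma_{\mathcal{MA}}$ can be replaced by its setting-unlabelled version $\phi$. 4. (non-contradictory outcomes) There is no agent $A$ with $K_A(\vec{a}_j=\vec{v}_j\wedge\vec{a}_j=\neg\vec{v}_j)$ for some value assignment $\vec{v}_j$ to a set $\vec{a}_j$ of outcomes in the setup. If $\mathbb{T}$ includes a multi-agent setup for which these four cannot hold simultaneously, $\mathbb{T}$ admits (entails) a multi-agent paradox. **Post-selection free $n$-cycle paradox.** Consider a multi-agent setup with $n$ agents, where agent $A_i$ has outcome $x_i\in\{0,1\}$ and only adjacent pairs of agents $(A_1,A_2),(A_2,A_3),\dots,(A_{n-1},A_n),(A_n,A_1)$ are compatible. A post-selection free $n$-cycle paradox is any multi-agent paradox in such a setup in which agents reasoning with the four assumptions of a multi-agent paradox (common knowledge, reasoning about compatible agents, setting-independence, non-contradictory outcomes) obtain, for some $i\in\{1,\dots,n\}$, the two chains of inferences $$x_i=0\Rightarrow x_{i+1}=v_{i+1}\Rightarrow x_{i+2}=v_{i+2}\Rightarrow\dots\Rightarrow x_{i-1}=v_{i-1}\Rightarrow x_i=1,$$ $$x_i=1\Rightarrow x_{i+1}=v'_{i+1}\Rightarrow x_{i+2}=v'_{i+2}\Rightarrow\dots\Rightarrow x_{i-1}=v'_{i-1}\Rightarrow x_i=0,$$ where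 $v_j,v'_j\in\{0,1\}$ and $v_j\neq v'_j$ for each $j\neq i$ in $\{1,\dots,n\}$, indices being modulo $n$. **$n$-cycle scenario and extremal vertices.** The $n$-cycle scenario has $n$ variables (measurements) $X_1,\dots,X_n$ with outcomes $x_i\in\{0,1\}$ and contexts $C_i=(X_i,X_{i+1})$, $i=1,\dots,n$ (indices modulo $n$), meaning that adjacent measurements are jointly measurable. An empirical model specifies for each $i$ a distribution $e_{C_i}=P(x_i,x_{i+1})$. Put $\langle X_i,X_{i+1}\rangle:=P(x_i=x_{i+1})-P(x_i\neq x_{i+1})$ and $\Omega=\sum_{i=1}^n\gamma_i\langle X_i,X_{i+1}\rangle$ with $\gamma_i\in\{+1,-1\}$ and an odd number of $\gamma_i=-1$. "Extremal vertex of the non-disturbance polytope" here means a model achieving the maximal value $\Omega=n$ for some such choice of $\gamma$, i.e. $\langle X_i,X_{i+1}\rangle=\gamma_i$ for every $i$, with an odd number of $\gamma_i=-1$. The theory $\mathbb{T}$ contains such a vertex if it admits correlations between $n$ measurements $X_1,\dots,X_n$ of an $n$-cycle scenario achieving this.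
   Formalization: One primed measurement M'_j per agent must serve all its adjacent pairs; "only adjacent pairs compatible" restricts the reasoning but does not forbid other compatible sets; theories are assumed to have independent preparation, restriction of states, fresh memories and unnoticed recording. *)

theory Defs
  imports Complex_Main "HOL-Library.FuncSet"
begin

section \<open>Physical theories\<close>

text \<open>\<open>Record m L\<close> is the measurement \<open>m\<close> whose result is written into the memory \<open>L\<close>.\<close>

datatype ('s, 't, 'm) operation = Evolve 't | Measure 'm | Record 'm 's

text \<open>
  States, transformations and measurements are indexed by the finite set of systems they live on.
  \<open>prob T \<rho> ops xs\<close> is the probability that the time-ordered operations \<open>ops\<close>, applied to the
  state \<open>\<rho>\<close>, yield the outcomes \<open>xs\<close>: one entry for each \<open>Measure\<close> or \<open>Record\<close> in \<open>ops\<close>, in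
  the same order.
\<close>

record ('s, 'r, 't, 'm) phys_theory =
  states :: "'s set \<Rightarrow> 'r set"
  transformations :: "'s set \<Rightarrow> 't set"
  measurements :: "'s set \<Rightarrow> 'm set"
  outcomes :: "'m \<Rightarrow> nat set"
  ident :: "'s set \<Rightarrow> 't"
  par :: "'r \<Rightarrow> 'r \<Rightarrow> 'r"  \<comment> \<open>independent preparation on disjoint systems\<close>
  reduce :: "'r \<Rightarrow> 's set \<Rightarrow> 'r"  \<comment> \<open>state of a subset of the systems\<close>
  can_store :: "'m \<Rightarrow> 's \<Rightarrow> bool"
  prob :: "'r \<Rightarrow> ('s, 't, 'm) operation list \<Rightarrow> nat list \<Rightarrow> real"

fun acts_on :: "('s, 'r, 't, 'm) phys_theory \<Rightarrow> 's set \<Rightarrow> ('s, 't, 'm) operation \<Rightarrow> bool" where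
  "acts_on T U (Evolve t) \<longleftrightarrow> t \<in> transformations T U"
| "acts_on T U (Measure m) \<longleftrightarrow> m \<in> measurements T U"
| "acts_on T U (Record m L) \<longleftrightarrow> L \<in> U \<and> m \<in> measurements T (U - {L}) \<and> can_store T m L"

fun operation_outcomes :: "('s, 'r, 't, 'm) phys_theory \<Rightarrow> ('s, 't, 'm) operation \<Rightarrow> nat set list" where
  "operation_outcomes T (Evolve t) = []"
| "operation_outcomes T (Measure m) = [outcomes T m]"
| "operation_outcomes T (Record m L) = [outcomes T m]"

text \<open>
  By \<open>extend_transformation\<close> and \<open>extend_measurement\<close> an operation may be regarded as acting on
  more systems, with identities appended; by \<open>reduce_prob\<close> and \<open>par_reduce\<close> systems on which
  nothing acts do not influence the statistics. No relation is assumed between sequential and joint measurements, between a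
  measurement and any evolution, or between the statistics of scenarios other than those listed.
\<close>

locale physical_theory =
  fixes T :: "('s, 'r, 't, 'm) phys_theory"
  assumes finite_outcomes: "m \<in> measurements T U \<Longrightarrow> finite (outcomes T m)"
    and extend_transformation:
      "finite V \<Longrightarrow> U \<subseteq> V \<Longrightarrow> transformations T U \<subseteq> transformations T V"
    and extend_measurement: "finite V \<Longrightarrow> U \<subseteq> V \<Longrightarrow> measurements T U \<subseteq> measurements T V"
    and prob_nonneg:
      "finite U \<Longrightarrow> \<rho> \<in> states T U \<Longrightarrow> \<forall>x\<in>set ops. acts_on T U x \<Longrightarrow> 0 \<le> prob T \<rho> ops xs"
    and prob_normalised:
      "finite U \<Longrightarrow> \<rho> \<in> states T U \<Longrightarrow> \<forall>x\<in>set ops. acts_on T U x \<Longrightarrow>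
        (\<Sum>xs \<in> listset (concat (map (operation_outcomes T) ops)). prob T \<rho> ops xs) = 1"
    and ident_transformation: "finite U \<Longrightarrow> ident T U \<in> transformations T U"
    and ident_trivial:
      "finite U \<Longrightarrow> \<rho> \<in> states T U \<Longrightarrow> R \<subseteq> U \<Longrightarrow> \<forall>x\<in>set (ops @ ops'). acts_on T U x \<Longrightarrow>
        prob T \<rho> (ops @ Evolve (ident T R) # ops') = prob T \<rho> (ops @ ops')"
    and reduce_state: "finite U \<Longrightarrow> \<rho> \<in> states T U \<Longrightarrow> R \<subseteq> U \<Longrightarrow> reduce T \<rho> R \<in> states T R"
    and reduce_prob:
      "finite U \<Longrightarrow> \<rho> \<in> states T U \<Longrightarrow> R \<subseteq> U \<Longrightarrow> \<forall>x\<in>set ops. acts_on T R x \<Longrightarrow>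
        prob T (reduce T \<rho> R) ops = prob T \<rho> ops"
    and par_state:
      "finite U \<Longrightarrow> finite V \<Longrightarrow> U \<inter> V = {} \<Longrightarrow> \<rho> \<in> states T U \<Longrightarrow> \<sigma> \<in> states T V \<Longrightarrow>
        par T \<rho> \<sigma> \<in> states T (U \<union> V)"
    and par_reduce:
      "finite U \<Longrightarrow> finite V \<Longrightarrow> U \<inter> V = {} \<Longrightarrow> \<rho> \<in> states T U \<Longrightarrow> \<sigma> \<in> states T V \<Longrightarrow>
        reduce T (par T \<rho> \<sigma>) U = \<rho>"
    and memory_supply:
      "finite U \<Longrightarrow> finite F \<Longrightarrow> m \<in> measurements T U \<Longrightarrow>
        \<exists>L. L \<notin> F \<and> can_store T m L \<and> states T {L} \<noteq> {}"
    and record_statistics:  \<comment> \<open>writing into a memory that nothing else touches is not noticed\<close>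
      "finite U \<Longrightarrow> \<rho> \<in> states T U \<Longrightarrow> acts_on T U (Record m L) \<Longrightarrow>
        \<forall>x\<in>set (ops @ ops'). acts_on T (U - {L}) x \<Longrightarrow>
        prob T \<rho> (ops @ Record m L # ops') = prob T \<rho> (ops @ Measure m # ops')"

text \<open>The measurements \<open>X i\<close>, \<open>i \<in> I\<close>, are applied to \<open>\<rho>\<close> in the order of their indices.\<close>

definition apply_prob ::
    "('s, 'r, 't, 'm) phys_theory \<Rightarrow> 'r \<Rightarrow> (nat \<Rightarrow> 'm) \<Rightarrow> nat set \<Rightarrow> (nat \<Rightarrow> nat) \<Rightarrow> real" where
  "apply_prob T \<rho> X I a =
     prob T \<rho> (map (\<lambda>i. Measure (X i)) (sorted_list_of_set I)) (map a (sorted_list_of_set I))"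

text \<open>\<open>f\<close> names the outcomes of \<open>J\<close> by the elements of the product of the outcome sets.\<close>

definition jointly_measurable ::
    "('s, 'r, 't, 'm) phys_theory \<Rightarrow> 's set \<Rightarrow> (nat \<Rightarrow> 'm) \<Rightarrow> nat set \<Rightarrow> bool" where
  "jointly_measurable T U X I \<longleftrightarrow>
     (\<forall>i\<in>I. X i \<in> measurements T U) \<and>
     (\<forall>\<rho>\<in>states T U. \<exists>J\<in>measurements T U. \<exists>f.
        bij_betw f (outcomes T J) (PiE I (\<lambda>i. outcomes T (X i))) \<and>
        (\<forall>i\<in>I. \<forall>x\<in>outcomes T (X i).
           (\<Sum>y | y \<in> outcomes T J \<and> f y i = x. prob T \<rho> [Measure J] [y])
             = prob T \<rho> [Measure (X i)] [x]))"


section \<open>Multi-agent setups\<close>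

text \<open>
  The agents are \<open>1, \<dots>, agents MA\<close>, numbered in the order of their measurement times. The
  measurement of agent \<open>i\<close> is modelled by \<open>Record (recorded MA i) (lab MA i)\<close> under the setting 1
  and by \<open>Evolve (evolution MA i)\<close> under the setting 0.
\<close>

record ('s, 'r, 't, 'm) agent_setup =
  agents :: nat
  systems :: "'s set"
  initial :: 'r
  lab :: "nat \<Rightarrow> 's"
  lab_state :: "nat \<Rightarrow> 'r"
  measured :: "nat \<Rightarrow> 's set"
  recorded :: "nat \<Rightarrow> 'm"
  evolution :: "nat \<Rightarrow> 't"

definition all_systems :: "('s, 'r, 't, 'm) agent_setup \<Rightarrow> 's set" where
  "all_systems MA = systems MA \<union> lab MA ` {1..agents MA}"

definition multi_agent_setup ::
    "('s, 'r, 't, 'm) phys_theory \<Rightarrow> ('s, 'r, 't, 'm) agent_setup \<Rightarrow> bool" where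
  "multi_agent_setup T MA \<longleftrightarrow>
     finite (systems MA) \<and> initial MA \<in> states T (systems MA) \<and>
     inj_on (lab MA) {1..agents MA} \<and>
     (\<forall>i\<in>{1..agents MA}.
        lab MA i \<notin> systems MA \<and> lab_state MA i \<in> states T {lab MA i} \<and>
        measured MA i \<subseteq> all_systems MA - {lab MA i} \<and>
        recorded MA i \<in> measurements T (measured MA i) \<and>
        can_store T (recorded MA i) (lab MA i) \<and>
        evolution MA i \<in> transformations T (insert (lab MA i) (measured MA i)))"

definition initial_state :: "('s, 'r, 't, 'm) phys_theory \<Rightarrow> ('s, 'r, 't, 'm) agent_setup \<Rightarrow> 'r" where
  "initial_state T MA =
     foldl (\<lambda>\<rho> i. par T \<rho> (lab_state MA i)) (initial MA) [1..<Suc (agents MA)]"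

type_synonym settings = "nat \<Rightarrow> bool"

definition scenario ::
    "('s, 'r, 't, 'm) agent_setup \<Rightarrow> settings \<Rightarrow> ('s, 't, 'm) operation list" where
  "scenario MA s =
     map (\<lambda>i. if s i then Record (recorded MA i) (lab MA i) else Evolve (evolution MA i))
       [1..<Suc (agents MA)]"

definition joint_prob ::
    "('s, 'r, 't, 'm) phys_theory \<Rightarrow> ('s, 'r, 't, 'm) agent_setup \<Rightarrow> settings \<Rightarrow> (nat \<Rightarrow> nat) \<Rightarrow> real" where
  "joint_prob T MA s a =
     prob T (initial_state T MA) (scenario MA s) (map a (filter s [1..<Suc (agents MA)]))"

text \<open>
  A value assignment to a set of outcomes is a finite map from agents to values, whose domain is
  that set. \<open>setup_prob T MA s v\<close> is the probability of the values \<open>v\<close> under the settings \<open>s\<close>.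
\<close>

definition setup_prob ::
    "('s, 'r, 't, 'm) phys_theory \<Rightarrow> ('s, 'r, 't, 'm) agent_setup \<Rightarrow> settings \<Rightarrow> (nat \<rightharpoonup> nat) \<Rightarrow> real" where
  "setup_prob T MA s v =
     (\<Sum>a | a \<in> PiE {i\<in>{1..agents MA}. s i} (\<lambda>i. outcomes T (recorded MA i)) \<and>
            (\<forall>i\<in>dom v. v i = Some (a i)). joint_prob T MA s a)"

text \<open>The settings under which a default prediction for the outcomes in \<open>I\<close> is computed.\<close>

definition default_settings :: "nat set \<Rightarrow> settings" where
  "default_settings I = (\<lambda>i. i \<in> I)"

text \<open>
  The default prediction for \<open>v\<close> given \<open>w\<close>. It has the value 0, hence never the value 1, if \<open>w\<close>
  has probability 0.
\<close>

definition default_prediction ::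
    "('s, 'r, 't, 'm) phys_theory \<Rightarrow> ('s, 'r, 't, 'm) agent_setup \<Rightarrow> (nat \<rightharpoonup> nat) \<Rightarrow> (nat \<rightharpoonup> nat) \<Rightarrow> real" where
  "default_prediction T MA v w =
     (let s = default_settings (dom v \<union> dom w)
      in setup_prob T MA s (w ++ v) / setup_prob T MA s w)"


section \<open>Compatibility of agents\<close>

text \<open>
  \<open>M' j\<close> is the primed measurement of agent \<open>j\<close>. It is one and the same in all sets of \<open>\<C>\<close> that
  contain \<open>j\<close>; compatibility of a single set \<open>C\<close> is the case \<open>\<C> = {C}\<close>. Were \<open>M' j\<close> allowed
  to depend on the set, classical bits flipped by the setting-0 evolution of another agent would
  already behave paradoxically.
\<close>

definition compatible_via ::
    "('s, 'r, 't, 'm) phys_theory \<Rightarrow> ('s, 'r, 't, 'm) agent_setup \<Rightarrow> (nat \<Rightarrow> 'm) \<Rightarrow> nat set \<Rightarrow> bool" where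
  "compatible_via T MA M' C \<longleftrightarrow>
     C \<subseteq> {1..agents MA} \<and>
     (\<forall>j\<in>C. M' j \<in> measurements T (all_systems MA) \<and>
            outcomes T (M' j) = outcomes T (recorded MA j)) \<and>
     (\<forall>a \<in> PiE C (\<lambda>j. outcomes T (recorded MA j)).
        joint_prob T MA (default_settings C) a = apply_prob T (initial_state T MA) M' C a) \<and>
     (\<forall>j\<in>C. \<forall>x\<in>outcomes T (recorded MA j).
        setup_prob T MA (default_settings C) [j \<mapsto> x]
          = prob T (initial_state T MA) [Measure (M' j)] [x]) \<and>
     jointly_measurable T (all_systems MA) M' C"

definition compatibility_structure ::
    "('s, 'r, 't, 'm) phys_theory \<Rightarrow> ('s, 'r, 't, 'm) agent_setup \<Rightarrow> nat set set \<Rightarrow> bool" where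
  "compatibility_structure T MA \<C> \<longleftrightarrow> (\<exists>M'. \<forall>C\<in>\<C>. compatible_via T MA M' C)"


section \<open>Statements and knowledge\<close>

datatype statement =
    Outcome "nat \<rightharpoonup> nat"
  | Negated "nat \<rightharpoonup> nat"
  | Inference "nat \<rightharpoonup> nat" "nat \<rightharpoonup> nat"

definition setup_statements ::
    "('s, 'r, 't, 'm) phys_theory \<Rightarrow> ('s, 'r, 't, 'm) agent_setup \<Rightarrow> (statement \<times> settings) set" where
  "setup_statements T MA =
     {(Outcome v, default_settings (dom v)) | v.
        dom v \<noteq> {} \<and> dom v \<subseteq> {1..agents MA} \<and> default_prediction T MA v Map.empty > 0} \<union>
     {(Inference w v, default_settings (dom v \<union> dom w)) | w v.
        dom v \<noteq> {} \<and> dom v \<inter> dom w = {} \<and> dom v \<union> dom w \<subseteq> {1..agents MA} \<and>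
        default_prediction T MA v w = 1}"

text \<open>
  \<open>knows T MA \<C> E [A\<^sub>1, \<dots>, A\<^sub>k] (\<phi>, l)\<close> says that \<open>K\<^bsub>A\<^sub>1\<^esub> \<dots> K\<^bsub>A\<^sub>k\<^esub> \<phi>\<close> is concluded
  by the agents, where \<open>l\<close> is \<open>Some s\<close> for the setting-labelled statement and \<open>None\<close> for the
  unlabelled one. Only the sets of agents in \<open>\<C>\<close>, and their subsets, count as compatible.
  \<open>E\<close> lists the agents that have learnt an outcome of the given run; an atomic
  outcome statement is merely possible in a run and is therefore known only if listed there,
  whereas the inferences follow from the theory and \<open>MA\<close> and are common knowledge.
  The rules \<open>part\<close>, \<open>join\<close> and \<open>negation\<close> treat a vector of outcomes as a conjunction.
\<close>

inductive knows ::
    "('s, 'r, 't, 'm) phys_theory \<Rightarrow> ('s, 'r, 't, 'm) agent_setup \<Rightarrow> nat set set \<Rightarrow>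
     (nat \<times> statement \<times> settings) set \<Rightarrow> nat list \<Rightarrow> statement \<times> settings option \<Rightarrow> bool"
  for T :: "('s, 'r, 't, 'm) phys_theory" and MA :: "('s, 'r, 't, 'm) agent_setup"
    and \<C> :: "nat set set" and E :: "(nat \<times> statement \<times> settings) set" where
  common_knowledge:
    "(Inference w v, s) \<in> setup_statements T MA \<Longrightarrow> C \<in> \<C> \<Longrightarrow> dom v \<union> dom w \<subseteq> C \<Longrightarrow>
     u \<noteq> [] \<Longrightarrow> set u \<subseteq> {1..agents MA} \<Longrightarrow> knows T MA \<C> E u (Inference w v, Some s)"
| observation:
    "(Outcome v, s) \<in> setup_statements T MA \<Longrightarrow> C \<in> \<C> \<Longrightarrow> dom v \<subseteq> C \<Longrightarrow>
     (A, Outcome v, s) \<in> E \<Longrightarrow> set (u @ [A]) \<subseteq> {1..agents MA} \<Longrightarrow>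
     knows T MA \<C> E (u @ [A]) (Outcome v, Some s)"
| trust:
    "knows T MA \<C> E (u @ [A, B]) \<phi> \<Longrightarrow> C \<in> \<C> \<Longrightarrow> {A, B} \<subseteq> C \<Longrightarrow> knows T MA \<C> E (u @ [A]) \<phi>"
| setting_independence:
    "knows T MA \<C> E u (\<phi>, Some s) \<Longrightarrow> knows T MA \<C> E u (\<phi>, None)"
| distribution:
    "w = Map.empty \<or> knows T MA \<C> E u (Outcome w, None) \<Longrightarrow>
     knows T MA \<C> E u (Inference w v, None) \<Longrightarrow> knows T MA \<C> E u (Outcome v, None)"
| part:
    "knows T MA \<C> E u (Outcome v, None) \<Longrightarrow> v' \<subseteq>\<^sub>m v \<Longrightarrow> dom v' \<noteq> {} \<Longrightarrow>
     knows T MA \<C> E u (Outcome v', None)"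
| join:
    "knows T MA \<C> E u (Outcome v, None) \<Longrightarrow> knows T MA \<C> E u (Outcome w, None) \<Longrightarrow>
     \<forall>i \<in> dom v \<inter> dom w. v i = w i \<Longrightarrow> C \<in> \<C> \<Longrightarrow> dom v \<union> dom w \<subseteq> C \<Longrightarrow>
     knows T MA \<C> E u (Outcome (v ++ w), None)"
| negation:
    "knows T MA \<C> E u (Outcome w, None) \<Longrightarrow> dom v = dom w \<Longrightarrow> v \<noteq> w \<Longrightarrow>
     knows T MA \<C> E u (Negated v, None)"

definition non_contradictory_outcomes ::
    "('s, 'r, 't, 'm) phys_theory \<Rightarrow> ('s, 'r, 't, 'm) agent_setup \<Rightarrow> nat set set \<Rightarrow>
     (nat \<times> statement \<times> settings) set \<Rightarrow> bool" where
  "non_contradictory_outcomes T MA \<C> E \<longleftrightarrow>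
     \<not> (\<exists>A\<in>{1..agents MA}. \<exists>v.
          knows T MA \<C> E [A] (Outcome v, None) \<and> knows T MA \<C> E [A] (Negated v, None))"

definition multi_agent_paradox ::
    "('s, 'r, 't, 'm) phys_theory \<Rightarrow> ('s, 'r, 't, 'm) agent_setup \<Rightarrow> nat set set \<Rightarrow> bool" where
  "multi_agent_paradox T MA \<C> \<longleftrightarrow>
     multi_agent_setup T MA \<and> compatibility_structure T MA \<C> \<and>
     (\<exists>A v s. (Outcome v, s) \<in> setup_statements T MA \<and>
        \<not> non_contradictory_outcomes T MA \<C> {(A, Outcome v, s)})"


section \<open>Post-selection free paradoxes on a cycle\<close>

text \<open>Indices on the cycle run through \<open>1, \<dots>, n\<close>.\<close>

definition next_index :: "nat \<Rightarrow> nat \<Rightarrow> nat" where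
  "next_index n i = i mod n + 1"

definition cycle_contexts :: "nat \<Rightarrow> nat set set" where
  "cycle_contexts n = (\<lambda>i. {i, next_index n i}) ` {1..n}"

text \<open>
  The chain once around the cycle, from \<open>x\<^sub>i = b\<close> via \<open>x\<^sub>j = v j\<close>, \<open>j \<noteq> i\<close>, back to
  \<open>x\<^sub>i = c\<close>. No outcome is presupposed: the set of observations is empty.
\<close>

definition inference_chain ::
    "('s, 'r, 't, 'm) phys_theory \<Rightarrow> ('s, 'r, 't, 'm) agent_setup \<Rightarrow> nat \<Rightarrow> nat \<Rightarrow> nat \<Rightarrow> nat \<Rightarrow>
     (nat \<Rightarrow> nat) \<Rightarrow> nat \<Rightarrow> bool" where
  "inference_chain T MA n A i b v c \<longleftrightarrow>
     (\<forall>j\<in>{1..n}.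
        knows T MA (cycle_contexts n) {} [A]
          (Inference [j \<mapsto> (if j = i then b else v j)]
             [next_index n j \<mapsto> (if next_index n j = i then c else v (next_index n j))], None))"

text \<open>
  That only adjacent agents are compatible means that \<open>cycle_contexts n\<close> is the structure by which
  the agents' reasoning is restricted; further sets that happen to be jointly measurable in the
  theory are not excluded, but cannot be used.
\<close>

definition post_selection_free_cycle_paradox ::
    "('s, 'r, 't, 'm) phys_theory \<Rightarrow> nat \<Rightarrow> ('s, 'r, 't, 'm) agent_setup \<Rightarrow> bool" where
  "post_selection_free_cycle_paradox T n MA \<longleftrightarrow>
     agents MA = n \<and> (\<forall>i\<in>{1..n}. outcomes T (recorded MA i) = {0, 1}) \<and>
     multi_agent_paradox T MA (cycle_contexts n) \<and>
     (\<exists>A\<in>{1..n}. \<exists>i\<in>{1..n}. \<exists>v v'.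
        (\<forall>j\<in>{1..n} - {i}. v j \<in> {0, 1} \<and> v' j \<in> {0, 1} \<and> v j \<noteq> v' j) \<and>
        inference_chain T MA n A i 0 v 1 \<and> inference_chain T MA n A i 1 v' 0)"

definition admits_post_selection_free_cycle_paradox ::
    "('s, 'r, 't, 'm) phys_theory \<Rightarrow> nat \<Rightarrow> bool" where
  "admits_post_selection_free_cycle_paradox T n \<longleftrightarrow>
     (\<exists>MA. post_selection_free_cycle_paradox T n MA)"


section \<open>The cycle scenario and its extremal vertices\<close>

text \<open>An empirical model \<open>e\<close> has \<open>e i a b = P(x\<^sub>i = a, x\<^sub>i\<^sub>+\<^sub>1 = b)\<close> for \<open>a, b \<in> {0, 1}\<close>.\<close>

definition non_disturbance_polytope :: "nat \<Rightarrow> (nat \<Rightarrow> nat \<Rightarrow> nat \<Rightarrow> real) set" where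
  "non_disturbance_polytope n =
     {e. \<forall>i\<in>{1..n}.
        (\<forall>a\<in>{0, 1}. \<forall>b\<in>{0, 1}. 0 \<le> e i a b) \<and>
        (\<Sum>a\<in>{0, 1}. \<Sum>b\<in>{0, 1}. e i a b) = 1 \<and>
        (\<forall>x\<in>{0, 1}. (\<Sum>a\<in>{0, 1}. e i a x) = (\<Sum>b\<in>{0, 1}. e (next_index n i) x b))}"

definition correlator :: "(nat \<Rightarrow> nat \<Rightarrow> nat \<Rightarrow> real) \<Rightarrow> nat \<Rightarrow> real" where
  "correlator e i = (e i 0 0 + e i 1 1) - (e i 0 1 + e i 1 0)"

definition extremal_vertex :: "nat \<Rightarrow> (nat \<Rightarrow> nat \<Rightarrow> nat \<Rightarrow> real) \<Rightarrow> bool" where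
  "extremal_vertex n e \<longleftrightarrow>
     e \<in> non_disturbance_polytope n \<and>
     (\<exists>\<gamma>. (\<forall>i\<in>{1..n}. \<gamma> i \<in> {1, -1}) \<and> odd (card {i\<in>{1..n}. \<gamma> i = -1}) \<and>
        (\<Sum>i = 1..n. \<gamma> i * correlator e i) = real n)"

text \<open>
  The correlations obtained by applying adjacent, jointly measurable \<open>X i\<close> to a state \<open>\<rho>\<close>; the
  marginals are the distributions of the single measurements.
\<close>

definition admits_correlations ::
    "('s, 'r, 't, 'm) phys_theory \<Rightarrow> nat \<Rightarrow> (nat \<Rightarrow> nat \<Rightarrow> nat \<Rightarrow> real) \<Rightarrow> bool" where
  "admits_correlations T n e \<longleftrightarrow>
     (\<exists>U \<rho> X. finite U \<and> \<rho> \<in> states T U \<and>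
        (\<forall>i\<in>{1..n}. X i \<in> measurements T U \<and> outcomes T (X i) = {0, 1}) \<and>
        (\<forall>i\<in>{1..n}.
           jointly_measurable T U X {i, next_index n i} \<and>
           (\<forall>a\<in>{0, 1}. \<forall>b\<in>{0, 1}.
              e i a b = apply_prob T \<rho> X {i, next_index n i} (\<lambda>j. if j = i then a else b)) \<and>
           (\<forall>a\<in>{0, 1}. (\<Sum>b\<in>{0, 1}. e i a b) = prob T \<rho> [Measure (X i)] [a]) \<and>
           (\<forall>b\<in>{0, 1}. (\<Sum>a\<in>{0, 1}. e i a b) = prob T \<rho> [Measure (X (next_index n i))] [b])))"

definition contains_extremal_vertex :: "('s, 'r, 't, 'm) phys_theory \<Rightarrow> nat \<Rightarrow> bool" where
  "contains_extremal_vertex T n \<longleftrightarrow> (\<exists>e. admits_correlations T n e \<and> extremal_vertex n e)"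

end

theory Submission
  imports Defs
begin

text \<open>
  The two chains of inferences assign to every edge of the cycle two pairs of values of probability
  0, which make the adjacent outcomes perfectly correlated or perfectly anti-correlated; as the
  value of \<open>x\<^sub>i\<close> flips after one turn, the number of anti-correlated edges is odd. Conversely,
  perfect correlations with an odd number of anti-correlated edges force uniform marginals, so that
  all conditional probabilities along the cycle are defined and equal 1, and both chains are
  inferences of the setup in which the agents measure the \<open>X i\<close> and do nothing under the setting 0.
\<close>

section \<open>The cycle\<close>

text \<open>The obstacle is that the default predictions for different edges are computed under
  different settings, and a theory need not relate such scenarios. Starting from a paradox, the
  primed measurements tie the edges together: one family serves all edges, and each single outcome
  has the statistics of its primed measurement alone, which makes the edges one non-disturbing
  model. Starting from a vertex, the identity under the setting 0 does so: each scenario reduces to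
  the measurements that it records, provided that nobody touches the memory of another
  agent.\<close>

lemma next_index_eq: "i \<in> {1..n} \<Longrightarrow> next_index n i = (if i = n then 1 else Suc i)"
  by (auto simp: next_index_def)

lemma next_index_in: "i \<in> {1..n} \<Longrightarrow> next_index n i \<in> {1..n}"
  by (auto simp: next_index_eq)

lemma next_index_neq: "2 \<le> n \<Longrightarrow> i \<in> {1..n} \<Longrightarrow> next_index n i \<noteq> i"
  by (auto simp: next_index_eq)

lemma bij_betw_next_index: "bij_betw (next_index n) {1..n} {1..n}"
proof -
  have "inj_on (next_index n) {1..n}"
    by (auto simp: inj_on_def next_index_eq split: if_splits)
  moreover have "next_index n ` {1..n} \<subseteq> {1..n}"
    using next_index_in by blast
  ultimately show ?thesis
    using endo_inj_surj[of "{1..n}" "next_index n"] by (simp add: bij_betw_def)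
qed


section \<open>Extremal vertices and perfect correlations\<close>

text \<open>
  Modulo 2, every \<open>src j\<close> is counted twice in the sum of all \<open>src j + tgt j\<close>, and the jump at
  \<open>i\<close> once.
\<close>

lemma odd_disagreements:
  fixes src tgt :: "nat \<Rightarrow> nat"
  assumes i: "i \<in> {1..n}"
    and src: "\<And>j. j \<in> {1..n} \<Longrightarrow> src j \<in> {0, 1}"
    and tgt: "\<And>j. j \<in> {1..n} \<Longrightarrow> tgt j \<in> {0, 1}"
    and link: "\<And>j. j \<in> {1..n} \<Longrightarrow>
      tgt j = src (next_index n j) + (if next_index n j = i then 1 else 0)"
  shows "odd (card {j \<in> {1..n}. src j \<noteq> tgt j})"
proof -
  have "(\<Sum>j\<in>{1..n}. src (next_index n j)) = (\<Sum>j\<in>{1..n}. src j)"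
    by (rule sum.reindex_bij_betw[OF bij_betw_next_index])
  moreover have "(\<Sum>j\<in>{1..n}. if next_index n j = i then 1 else 0)
      = (\<Sum>j\<in>{1..n}. if j = i then 1 else (0::nat))"
    by (rule sum.reindex_bij_betw[OF bij_betw_next_index])
  moreover have "(\<Sum>j\<in>{1..n}. tgt j)
      = (\<Sum>j\<in>{1..n}. src (next_index n j) + (if next_index n j = i then 1 else 0))"
    by (intro sum.cong link refl)
  ultimately have tgt_sum: "(\<Sum>j\<in>{1..n}. tgt j) = (\<Sum>j\<in>{1..n}. src j) + 1"
    using i by (simp add: sum.distrib)
  \<comment> \<open>For bits a and b, a + b = [a \<noteq> b] + 2ab, so the number of disagreements
    has the parity of the sum of all \<open>src j + tgt j\<close>.\<close>
  have "(\<Sum>j\<in>{1..n}. src j + tgt j)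
      = (\<Sum>j\<in>{1..n}. (if src j \<noteq> tgt j then 1 else 0) + 2 * (src j * tgt j))"
    using src tgt by (intro sum.cong) fastforce+
  moreover have "(\<Sum>j\<in>{1..n}. if src j \<noteq> tgt j then 1 else 0) = card {j \<in> {1..n}. src j \<noteq> tgt j}"
    by (subst sum.inter_filter[symmetric]) simp_all
  ultimately have "card {j \<in> {1..n}. src j \<noteq> tgt j} + 2 * (\<Sum>j\<in>{1..n}. src j * tgt j)
      = 2 * (\<Sum>j\<in>{1..n}. src j) + 1"
    using tgt_sum by (simp only: sum.distrib sum_distrib_left[symmetric])
  then have "odd (card {j \<in> {1..n}. src j \<noteq> tgt j} + 2 * (\<Sum>j\<in>{1..n}. src j * tgt j))"
    by (simp only:) simp
  then show ?thesis
    by simp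
qed

text \<open>The two forbidden pairs leave weight only on (\<open>src j\<close>,
  \<open>tgt j\<close>) and its complement, so the correlator is 1 or -1 according to whether the
  two values agree. As \<open>tgt\<close> has values in {0, 1}, \<open>link\<close> forces
  \<open>src i\<close> to be 0 and describes a turn from x_i = 0 to x_i = 1.\<close>

lemma extremal_vertexI:
  assumes e: "e \<in> non_disturbance_polytope n" and i: "i \<in> {1..n}"
    and src: "\<And>j. j \<in> {1..n} \<Longrightarrow> src j \<in> {0, 1}"
    and tgt: "\<And>j. j \<in> {1..n} \<Longrightarrow> tgt j \<in> {0, 1}"
    and link: "\<And>j. j \<in> {1..n} \<Longrightarrow>
      tgt j = src (next_index n j) + (if next_index n j = i then 1 else 0)"
    and zero: "\<And>j. j \<in> {1..n} \<Longrightarrow> e j (src j) (1 - tgt j) = 0 \<and> e j (1 - src j) (tgt j) = 0"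
  shows "extremal_vertex n e"
proof -
  define \<gamma> :: "nat \<Rightarrow> real" where "\<gamma> j = (if src j \<noteq> tgt j then -1 else 1)" for j
  have "\<gamma> j * correlator e j = 1" if j: "j \<in> {1..n}" for j
  proof -
    have "e j 0 0 + e j 0 1 + (e j 1 0 + e j 1 1) = 1"
      using e j by (simp add: non_disturbance_polytope_def)
    then show ?thesis
      using src[OF j] tgt[OF j] zero[OF j] by (auto simp: \<gamma>_def correlator_def)
  qed
  then have "(\<Sum>j = 1..n. \<gamma> j * correlator e j) = real n"
    by simp
  moreover have "{j \<in> {1..n}. \<gamma> j = -1} = {j \<in> {1..n}. src j \<noteq> tgt j}"
    by (auto simp: \<gamma>_def)
  ultimately show ?thesis
    unfolding extremal_vertex_def
    using e odd_disagreements[OF i src tgt link] by (intro conjI exI[of _ \<gamma>]) (auto simp: \<gamma>_def)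
qed

text \<open>
  The probability of \<open>x\<^sub>j = src j\<close> does not change along the cycle, but after one turn it has become
  that of \<open>x\<^sub>1 = 1\<close>. Hence both values of every \<open>x\<^sub>j\<close> have probability 1/2.
\<close>

lemma extremal_vertexE:
  assumes ext: "extremal_vertex n e" and n: "0 < n"
  obtains src tgt :: "nat \<Rightarrow> nat" where
    "src 1 = 0"
    "\<And>j. j \<in> {1..n} \<Longrightarrow> src j \<in> {0, 1}"
    "\<And>j. tgt j = (if next_index n j = 1 then 1 else src (next_index n j))"
    "\<And>j. j \<in> {1..n} \<Longrightarrow> e j (src j) (tgt j) = 1/2 \<and> e j (1 - src j) (1 - tgt j) = 1/2 \<and>
       e j (src j) (1 - tgt j) = 0 \<and> e j (1 - src j) (tgt j) = 0"
proof -
  have e: "e \<in> non_disturbance_polytope n"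
    using ext by (simp add: extremal_vertex_def)
  obtain \<gamma> :: "nat \<Rightarrow> real" where \<gamma>: "\<And>j. j \<in> {1..n} \<Longrightarrow> \<gamma> j \<in> {1, -1}"
    and odd: "odd (card {j \<in> {1..n}. \<gamma> j = -1})"
    and sum: "(\<Sum>j = 1..n. \<gamma> j * correlator e j) = real n"
    using ext unfolding extremal_vertex_def by blast
  have pos: "0 \<le> e j 0 0" "0 \<le> e j 0 1" "0 \<le> e j 1 0" "0 \<le> e j 1 1"
    and norm: "e j 0 0 + e j 0 1 + (e j 1 0 + e j 1 1) = 1"
    and nd: "e j 0 0 + e j 1 0 = e (next_index n j) 0 0 + e (next_index n j) 0 1"
      "e j 0 1 + e j 1 1 = e (next_index n j) 1 0 + e (next_index n j) 1 1"
    if "j \<in> {1..n}" for j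
    using e that by (simp_all add: non_disturbance_polytope_def)
  \<comment> \<open>No term exceeds 1, so a sum of n forces every term to be 1.\<close>
  have "\<gamma> j * correlator e j \<le> 1" if "j \<in> {1..n}" for j
    using \<gamma>[OF that] pos[OF that] norm[OF that] by (auto simp: correlator_def)
  moreover have "(\<Sum>j = 1..n. 1 - \<gamma> j * correlator e j) = 0"
    using sum by (simp add: sum_subtractf)
  ultimately have "\<forall>j\<in>{1..n}. 1 - \<gamma> j * correlator e j = 0"
    by (subst (asm) sum_nonneg_eq_0_iff) auto
  then have perfect: "(\<gamma> j = 1 \<and> e j 0 1 = 0 \<and> e j 1 0 = 0) \<or> (\<gamma> j = -1 \<and> e j 0 0 = 0 \<and> e j 1 1 = 0)"
    if "j \<in> {1..n}" for j
    using \<gamma>[OF that] pos[OF that] norm[OF that] that by (fastforce simp: correlator_def)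
  \<comment> \<open>The parity of the number of anti-correlated edges between x_1 and x_j is the
    value that x_1 = 0 entails at j.\<close>
  define src where "src j = card {k \<in> {1..<j}. \<gamma> k = -1} mod 2" for j
  define tgt where "tgt j = (if next_index n j = 1 then 1 else src (next_index n j))" for j
  have src01: "src j \<in> {0, 1}" for j
    by (auto simp: src_def)
  have src_Suc: "src (Suc j) = (if \<gamma> j = -1 then 1 - src j else src j)" if "1 \<le> j" for j
  proof -
    have "{k \<in> {1..<Suc j}. \<gamma> k = -1}
        = (if \<gamma> j = -1 then insert j {k \<in> {1..<j}. \<gamma> k = -1} else {k \<in> {1..<j}. \<gamma> k = -1})"
      using that by (auto simp: less_Suc_eq)
    then show ?thesis
      by (auto simp: src_def mod2_eq_if)
  qed
  \<comment> \<open>The cycle is unrolled: index n + 1 stands for the return to x_1, and the odd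
    number of sign changes gives it the value 1, in agreement with \<open>tgt n\<close>.\<close>
  have "{1..<Suc n} = {1..n}"
    by auto
  then have "src (Suc n) = 1"
    using odd by (simp add: src_def odd_iff_mod_2_eq_one)
  then have tgt_eq: "tgt j = src (Suc j)" if "j \<in> {1..n}" for j
    using that by (auto simp: tgt_def next_index_eq)
  have zero: "e j (src j) (1 - tgt j) = 0 \<and> e j (1 - src j) (tgt j) = 0" if j: "j \<in> {1..n}" for j
    using perfect[OF j] src_Suc[of j] src01[of j] tgt_eq[OF j] j by auto
  define p where "p j = e j (src j) 0 + e j (src j) 1" for j
  have p_eq: "p j = e j (src j) (tgt j)" if j: "j \<in> {1..n}" for j
    using zero[OF j] src01[of "Suc j"] tgt_eq[OF j] by (auto simp: p_def)
  \<comment> \<open>By perfect correlation \<open>p j\<close> is also the probability of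
    \<open>tgt j\<close> at the far end of the edge j, and non-disturbance carries it over to the
    next edge.\<close>
  have p_next: "p j = e (next_index n j) (tgt j) 0 + e (next_index n j) (tgt j) 1"
    if j: "j \<in> {1..n}" for j
    using p_eq[OF j] zero[OF j] nd[OF j] src01[of j] src01[of "Suc j"] tgt_eq[OF j] by auto
  have const: "p (Suc k) = p 1" if "k < n" for k
    using that
  proof (induction k)
    case (Suc k)
    then have "p (Suc k) = p (Suc (Suc k))"
      using p_next[of "Suc k"] tgt_eq[of "Suc k"] by (simp add: next_index_eq p_def)
    with Suc show ?case
      by simp
  qed simp
  have "p n = p 1"
    using const[of "n - 1"] n by simp
  moreover have "p n = e 1 1 0 + e 1 1 1"
    using p_next[of n] n by (simp add: next_index_eq tgt_def)
  moreover have "src 1 = 0"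
    by (simp add: src_def)
  ultimately have p1: "p 1 = 1/2"
    using norm[of 1] n by (simp add: p_def)
  have half: "e j (src j) (tgt j) = 1/2" if j: "j \<in> {1..n}" for j
  proof -
    have "j - 1 < n" "Suc (j - 1) = j"
      using j by auto
    then show ?thesis
      using const[of "j - 1"] p1 p_eq[OF j] by simp
  qed
  show thesis
  proof (rule that[of src tgt])
    show "e j (src j) (tgt j) = 1/2 \<and> e j (1 - src j) (1 - tgt j) = 1/2 \<and>
       e j (src j) (1 - tgt j) = 0 \<and> e j (1 - src j) (tgt j) = 0" if j: "j \<in> {1..n}" for j
      using half[OF j] zero[OF j] norm[OF j] src01[of j] src01[of "Suc j"] tgt_eq[OF j] by auto
  qed (use src01 \<open>src 1 = 0\<close> in \<open>simp_all add: tgt_def\<close>)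
qed


section \<open>Predictions for pairs of binary outcomes\<close>

lemma sum_PiE_singleton: "(\<Sum>a\<in>PiE {i} B. f a) = (\<Sum>x\<in>B i. f (\<lambda>k\<in>{i}. x))"
proof -
  have "(\<lambda>k\<in>{i}. a i) = a" if "a \<in> PiE {i} B" for a
    using that by (auto simp: fun_eq_iff PiE_def extensional_def)
  then show ?thesis
    by (intro sum.reindex_bij_witness[where i = "\<lambda>x. \<lambda>k\<in>{i}. x" and j = "\<lambda>a. a i"])
      (simp_all add: PiE_iff)
qed

lemma sum_PiE_pair:
  assumes "i \<noteq> j"
  shows "(\<Sum>a\<in>PiE {i, j} B. f a) = (\<Sum>x\<in>B i. \<Sum>y\<in>B j. f (\<lambda>k\<in>{i, j}. if k = i then x else y))"
proof -
  have "(\<Sum>a\<in>PiE {i, j} B. f a) = (\<Sum>(x, y)\<in>B i \<times> B j. f (\<lambda>k\<in>{i, j}. if k = i then x else y))"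
    by (rule sum.reindex_bij_witness[where i = "\<lambda>(x, y). \<lambda>k\<in>{i, j}. if k = i then x else y"
          and j = "\<lambda>a. (a i, a j)"])
      (use assms in \<open>auto simp: fun_eq_iff PiE_def extensional_def restrict_def Pi_def
        intro!: arg_cong[where f = f]\<close>)
  then show ?thesis
    by (simp add: sum.cartesian_product)
qed

lemma joint_prob_cong:
  "(\<And>k. k \<in> {1..agents MA} \<Longrightarrow> s k \<Longrightarrow> a k = b k) \<Longrightarrow> joint_prob T MA s a = joint_prob T MA s b"
  unfolding joint_prob_def by (intro arg_cong[where f = "prob T _ _"] map_cong) auto

lemma apply_prob_cong:
  "finite I \<Longrightarrow> (\<And>k. k \<in> I \<Longrightarrow> a k = b k) \<Longrightarrow> apply_prob T \<rho> X I a = apply_prob T \<rho> X I b"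
  unfolding apply_prob_def by (intro arg_cong[where f = "prob T _ _"] map_cong) auto

text \<open>This serves the outcome statement about x_1 that starts the contradiction. The case
  \<open>v i = None\<close> covers the empty condition by which its default prediction is
  divided.\<close>

lemma setup_prob_single:
  assumes "i \<in> {1..agents MA}" "dom v \<subseteq> {i}" "finite (outcomes T (recorded MA i))"
  shows "setup_prob T MA (default_settings {i}) v =
    (\<Sum>x\<in>outcomes T (recorded MA i). if v i = None \<or> v i = Some x
       then joint_prob T MA (default_settings {i}) (\<lambda>_. x) else 0)"
proof -
  have dom: "{k \<in> {1..agents MA}. default_settings {i} k} = {i}"
    using assms(1) by (auto simp: default_settings_def)
  let ?B = "\<lambda>k. outcomes T (recorded MA k)"
  have "finite (PiE {i} ?B)"
    using assms(3) by (intro finite_PiE) auto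
  then have "setup_prob T MA (default_settings {i}) v =
      (\<Sum>a\<in>PiE {i} ?B. if \<forall>k\<in>dom v. v k = Some (a k)
         then joint_prob T MA (default_settings {i}) a else 0)"
    unfolding setup_prob_def dom by (subst sum.inter_filter[symmetric]) (simp_all add: Collect_conj_eq)
  also have "\<dots> = (\<Sum>x\<in>?B i. if v i = None \<or> v i = Some x
       then joint_prob T MA (default_settings {i}) (\<lambda>_. x) else 0)"
    unfolding sum_PiE_singleton
  proof (intro sum.cong refl if_cong)
    fix x
    show "(\<forall>k\<in>dom v. v k = Some ((\<lambda>k\<in>{i}. x) k)) \<longleftrightarrow> v i = None \<or> v i = Some x"
      using subset_singletonD[OF assms(2)] domIff[of i v] by auto
    show "joint_prob T MA (default_settings {i}) (\<lambda>k\<in>{i}. x)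
        = joint_prob T MA (default_settings {i}) (\<lambda>_. x)"
      by (rule joint_prob_cong) (auto simp: default_settings_def)
  qed
  finally show ?thesis .
qed

text \<open>The values are assigned by the same total function as in
  \<open>admits_correlations\<close>, so that predictions and empirical model can be compared entry
  by entry.\<close>

definition pair_prob ::
    "('s, 'r, 't, 'm) phys_theory \<Rightarrow> ('s, 'r, 't, 'm) agent_setup \<Rightarrow> nat \<Rightarrow> nat \<Rightarrow> nat \<Rightarrow> nat \<Rightarrow> real" where
  "pair_prob T MA i j x y = joint_prob T MA (default_settings {i, j}) (\<lambda>k. if k = i then x else y)"

text \<open>Unassigned outcomes are summed over, so a single formula yields the joint probability
  and both marginals.\<close>

lemma setup_prob_pair:
  assumes "i \<noteq> j" "{i, j} \<subseteq> {1..agents MA}" "dom v \<subseteq> {i, j}"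
    and "outcomes T (recorded MA i) = {0, 1}" "outcomes T (recorded MA j) = {0, 1}"
  shows "setup_prob T MA (default_settings {i, j}) v =
    (\<Sum>x\<in>{0, 1}. \<Sum>y\<in>{0, 1}.
       if (v i = None \<or> v i = Some x) \<and> (v j = None \<or> v j = Some y)
       then pair_prob T MA i j x y else 0)"
proof -
  have dom: "{k \<in> {1..agents MA}. default_settings {i, j} k} = {i, j}"
    using assms(2) by (auto simp: default_settings_def)
  let ?B = "\<lambda>k. outcomes T (recorded MA k)"
  have "\<forall>k\<in>{i, j}. finite (?B k)"
    unfolding ball_simps assms(4,5) by simp
  then have "finite (PiE {i, j} ?B)"
    by (intro finite_PiE) blast+
  then have "setup_prob T MA (default_settings {i, j}) v =
      (\<Sum>a\<in>PiE {i, j} ?B. if \<forall>k\<in>dom v. v k = Some (a k)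
         then joint_prob T MA (default_settings {i, j}) a else 0)"
    unfolding setup_prob_def dom by (subst sum.inter_filter[symmetric]) (simp_all add: Collect_conj_eq)
  also have "\<dots> = (\<Sum>x\<in>{0, 1}. \<Sum>y\<in>{0, 1}.
       if (v i = None \<or> v i = Some x) \<and> (v j = None \<or> v j = Some y)
       then pair_prob T MA i j x y else 0)"
    unfolding sum_PiE_pair[OF assms(1)] assms(4,5)
  proof (intro sum.cong refl if_cong)
    fix x y :: nat
    let ?a = "\<lambda>k\<in>{i, j}. if k = i then x else y"
    show "(\<forall>k\<in>dom v. v k = Some (?a k)) \<longleftrightarrow>
        (v i = None \<or> v i = Some x) \<and> (v j = None \<or> v j = Some y)"
    proof -
      have "(\<forall>k\<in>dom v. v k = Some (?a k)) \<longleftrightarrow> (\<forall>k\<in>{i, j}. v k = None \<or> v k = Some (?a k))"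
        using assms(3) by (meson domIff subsetD)
      then show ?thesis
        using assms(1) by simp
    qed
    show "joint_prob T MA (default_settings {i, j}) ?a = pair_prob T MA i j x y"
      unfolding pair_prob_def by (rule joint_prob_cong) (auto simp: default_settings_def)
  qed
  finally show ?thesis .
qed

lemma setup_prob_pair_marginal:
  assumes "i \<noteq> j" "{i, j} \<subseteq> {1..agents MA}"
    and "outcomes T (recorded MA i) = {0, 1}" "outcomes T (recorded MA j) = {0, 1}"
  shows "x \<in> {0, 1} \<Longrightarrow>
      setup_prob T MA (default_settings {i, j}) [i \<mapsto> x] = (\<Sum>y\<in>{0, 1}. pair_prob T MA i j x y)"
    and "y \<in> {0, 1} \<Longrightarrow>
      setup_prob T MA (default_settings {i, j}) [j \<mapsto> y] = (\<Sum>x\<in>{0, 1}. pair_prob T MA i j x y)"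
  using assms by (auto simp: setup_prob_pair)

lemma default_prediction_pair:
  assumes "i \<noteq> j" "{i, j} \<subseteq> {1..agents MA}"
    and "outcomes T (recorded MA i) = {0, 1}" "outcomes T (recorded MA j) = {0, 1}"
    and "x \<in> {0, 1}" "y \<in> {0, 1}"
  shows "default_prediction T MA [j \<mapsto> y] [i \<mapsto> x] =
    pair_prob T MA i j x y / (\<Sum>y\<in>{0, 1}. pair_prob T MA i j x y)"
proof -
  have "dom [j \<mapsto> y] \<union> dom [i \<mapsto> x] = {i, j}"
    by auto
  moreover have "setup_prob T MA (default_settings {i, j}) ([i \<mapsto> x] ++ [j \<mapsto> y])
      = pair_prob T MA i j x y"
    using assms by (subst setup_prob_pair) auto
  ultimately show ?thesis
    using setup_prob_pair_marginal(1)[OF assms(1-4)] assms(5)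
    by (simp add: default_prediction_def Let_def)
qed

text \<open>Inferences enter only through \<open>common_knowledge\<close>; \<open>trust\<close> and
  \<open>setting_independence\<close> pass them on unchanged, and every other rule concludes an
  \<open>Outcome\<close> or a \<open>Negated\<close>. Hence each link of a chain is a statement
  about probabilities.\<close>

lemma knows_Inference:
  "knows T MA \<C> E u (Inference w v, l) \<Longrightarrow> default_prediction T MA v w = 1"
proof (induction u "(Inference w v, l)" arbitrary: l rule: knows.induct)
  case (common_knowledge s C u)
  then show ?case
    by (auto simp: setup_statements_def)
qed auto


section \<open>States of setups\<close>

context physical_theory
begin

lemma acts_on_mono:
  assumes "finite V" "U \<subseteq> V" "acts_on T U x"
  shows "acts_on T V x"
proof (cases x)
  case (Record m L)
  moreover have "measurements T (U - {L}) \<subseteq> measurements T (V - {L})"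
    using assms by (intro extend_measurement) auto
  ultimately show ?thesis
    using assms by auto
qed (use assms(3) extend_transformation[OF assms(1,2)] extend_measurement[OF assms(1,2)] in auto)

lemma finite_all_systems: "multi_agent_setup T MA \<Longrightarrow> finite (all_systems MA)"
  by (simp add: multi_agent_setup_def all_systems_def)

text \<open>The memories are adjoined one by one. Each is a new system, so \<open>par_reduce\<close>
  recovers the previous state by reduction, and operations on \<open>systems MA\<close> do not
  notice the addition.\<close>

lemma initial_state:
  assumes MA: "multi_agent_setup T MA"
  shows "initial_state T MA \<in> states T (all_systems MA)"
    and "\<forall>x\<in>set ops. acts_on T (systems MA) x \<Longrightarrow>
      prob T (initial_state T MA) ops = prob T (initial MA) ops"
proof -
  have fin: "finite (systems MA)" and init: "initial MA \<in> states T (systems MA)"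
    and inj: "inj_on (lab MA) {1..agents MA}"
    and lab: "\<And>i. i \<in> {1..agents MA} \<Longrightarrow> lab MA i \<notin> systems MA"
      "\<And>i. i \<in> {1..agents MA} \<Longrightarrow> lab_state MA i \<in> states T {lab MA i}"
    using MA by (auto simp: multi_agent_setup_def)
  have "foldl (\<lambda>\<rho> i. par T \<rho> (lab_state MA i)) (initial MA) [1..<Suc k]
          \<in> states T (systems MA \<union> lab MA ` {1..k}) \<and>
      ((\<forall>x\<in>set ops. acts_on T (systems MA) x) \<longrightarrow>
        prob T (foldl (\<lambda>\<rho> i. par T \<rho> (lab_state MA i)) (initial MA) [1..<Suc k]) ops
          = prob T (initial MA) ops)"
    if "k \<le> agents MA" for k
    using that
  proof (induction k)
    case 0
    then show ?case
      using init by simp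
  next
    case (Suc k)
    let ?U = "systems MA \<union> lab MA ` {1..k}"
    let ?\<rho> = "foldl (\<lambda>\<rho> i. par T \<rho> (lab_state MA i)) (initial MA) [1..<Suc k]"
    let ?\<sigma> = "lab_state MA (Suc k)"
    have \<rho>: "?\<rho> \<in> states T ?U" and
      IH: "(\<forall>x\<in>set ops. acts_on T (systems MA) x) \<longrightarrow> prob T ?\<rho> ops = prob T (initial MA) ops"
      using Suc by simp_all
    have \<sigma>: "?\<sigma> \<in> states T {lab MA (Suc k)}"
      using Suc.prems by (intro lab) simp
    have "lab MA (Suc k) \<notin> lab MA ` {1..k}"
    proof
      assume "lab MA (Suc k) \<in> lab MA ` {1..k}"
      then obtain j where j: "j \<in> {1..k}" "lab MA (Suc k) = lab MA j"
        by blast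
      then have "Suc k = j"
        using Suc.prems by (intro inj_onD[OF inj]) auto
      with j(1) show False
        by simp
    qed
    then have disj: "?U \<inter> {lab MA (Suc k)} = {}"
      using lab(1)[of "Suc k"] Suc.prems by auto
    have finU: "finite ?U"
      using fin by simp
    have step: "par T ?\<rho> ?\<sigma> \<in> states T (?U \<union> {lab MA (Suc k)})"
      "reduce T (par T ?\<rho> ?\<sigma>) ?U = ?\<rho>"
      using par_state[OF finU _ disj \<rho> \<sigma>] par_reduce[OF finU _ disj \<rho> \<sigma>] by simp_all
    have "prob T (par T ?\<rho> ?\<sigma>) ops = prob T ?\<rho> ops" if "\<forall>x\<in>set ops. acts_on T (systems MA) x"
    proof -
      have "\<forall>x\<in>set ops. acts_on T ?U x"
        using that acts_on_mono[OF finU] by blast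
      then have "prob T (reduce T (par T ?\<rho> ?\<sigma>) ?U) ops = prob T (par T ?\<rho> ?\<sigma>) ops"
        using step(1) finU by (intro reduce_prob[of "?U \<union> {lab MA (Suc k)}"]) auto
      then show ?thesis
        using step(2) by simp
    qed
    moreover have "?U \<union> {lab MA (Suc k)} = systems MA \<union> lab MA ` {1..Suc k}"
      by (simp add: atLeastAtMostSuc_conv)
    moreover have "foldl (\<lambda>\<rho> i. par T \<rho> (lab_state MA i)) (initial MA) [1..<Suc (Suc k)]
        = par T ?\<rho> ?\<sigma>"
      by simp
    ultimately show ?case
      using step(1) IH by metis
  qed
  from this[of "agents MA"] show "initial_state T MA \<in> states T (all_systems MA)"
    and "\<forall>x\<in>set ops. acts_on T (systems MA) x \<Longrightarrow>
      prob T (initial_state T MA) ops = prob T (initial MA) ops"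
    by (simp_all add: initial_state_def all_systems_def)
qed

text \<open>In both edges that meet at i, the marginal of x_i is the distribution of
  \<open>X i\<close> measured alone, which does not refer to the edge. Normalisation, too, is that
  of \<open>X i\<close> alone.\<close>

lemma correlations_in_polytope:
  assumes U: "finite U" "\<rho> \<in> states T U"
    and X: "\<And>i. i \<in> {1..n} \<Longrightarrow> X i \<in> measurements T U \<and> outcomes T (X i) = {0, 1}"
    and e: "\<And>i a b. e i a b = apply_prob T \<rho> X {i, next_index n i} (\<lambda>j. if j = i then a else b)"
    and fst: "\<And>i a. i \<in> {1..n} \<Longrightarrow> a \<in> {0, 1} \<Longrightarrow>
      (\<Sum>b\<in>{0, 1}. e i a b) = prob T \<rho> [Measure (X i)] [a]"
    and snd: "\<And>i b. i \<in> {1..n} \<Longrightarrow> b \<in> {0, 1} \<Longrightarrow>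
      (\<Sum>a\<in>{0, 1}. e i a b) = prob T \<rho> [Measure (X (next_index n i))] [b]"
  shows "e \<in> non_disturbance_polytope n"
proof -
  have "(\<forall>a\<in>{0, 1}. \<forall>b\<in>{0, 1}. 0 \<le> e i a b) \<and> (\<Sum>a\<in>{0, 1}. \<Sum>b\<in>{0, 1}. e i a b) = 1 \<and>
      (\<forall>x\<in>{0, 1}. (\<Sum>a\<in>{0, 1}. e i a x) = (\<Sum>b\<in>{0, 1}. e (next_index n i) x b))"
    if i: "i \<in> {1..n}" for i
  proof (intro conjI ballI)
    fix a b :: nat
    show "0 \<le> e i a b"
      unfolding e apply_prob_def
    proof (rule prob_nonneg[OF U])
      have "X j \<in> measurements T U" if "j \<in> {i, next_index n i}" for j
        using that X i next_index_in[OF i] by blast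
      then show "\<forall>x\<in>set (map (\<lambda>j. Measure (X j)) (sorted_list_of_set {i, next_index n i})). acts_on T U x"
        by (simp del: sorted_list_of_set_insert_remove)
    qed
  next
    have "set_Cons {0, 1} {[]} = {[0], [1 :: nat]}"
      by (auto simp: set_Cons_def)
    moreover have "(\<Sum>xs \<in> listset (concat (map (operation_outcomes T) [Measure (X i)])).
        prob T \<rho> [Measure (X i)] xs) = 1"
      using X[OF i] by (intro prob_normalised[OF U]) simp
    ultimately have "(\<Sum>a\<in>{0, 1}. prob T \<rho> [Measure (X i)] [a]) = 1"
      using X[OF i] by simp
    then show "(\<Sum>a\<in>{0, 1}. \<Sum>b\<in>{0, 1}. e i a b) = 1"
      using fst[OF i] by (simp cong: sum.cong)
  next
    fix x :: nat
    assume "x \<in> {0, 1}"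
    then show "(\<Sum>a\<in>{0, 1}. e i a x) = (\<Sum>b\<in>{0, 1}. e (next_index n i) x b)"
      using fst[OF next_index_in[OF i]] snd[OF i] by presburger
  qed
  then show ?thesis
    by (simp add: non_disturbance_polytope_def)
qed


section \<open>From paradoxes to vertices\<close>

text \<open>The vertex is realised by the primed measurements. Compatibility equates their
  statistics on each edge with the default predictions, where the two chains produce the zeros that
  \<open>extremal_vertexI\<close> asks for.\<close>

lemma paradox_imp_vertex:
  assumes n: "2 \<le> n" and paradox: "post_selection_free_cycle_paradox T n MA"
  shows "contains_extremal_vertex T n"
proof -
  have ag: "agents MA = n" and out: "\<And>i. i \<in> {1..n} \<Longrightarrow> outcomes T (recorded MA i) = {0, 1}"
    and MA: "multi_agent_setup T MA"
    and compat: "compatibility_structure T MA (cycle_contexts n)"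
    using paradox by (auto simp: post_selection_free_cycle_paradox_def multi_agent_paradox_def)
  obtain A i v v' where i: "i \<in> {1..n}"
    and v: "\<And>j. j \<in> {1..n} \<Longrightarrow> j \<noteq> i \<Longrightarrow> v j \<in> {0, 1} \<and> v' j \<in> {0, 1} \<and> v j \<noteq> v' j"
    and chain: "inference_chain T MA n A i 0 v 1" "inference_chain T MA n A i 1 v' 0"
    using paradox unfolding post_selection_free_cycle_paradox_def by blast
  obtain X where X: "\<And>C. C \<in> cycle_contexts n \<Longrightarrow> compatible_via T MA X C"
    using compat by (auto simp: compatibility_structure_def)
  define \<rho> where "\<rho> = initial_state T MA"
  define e where "e j a b = apply_prob T \<rho> X {j, next_index n j} (\<lambda>k. if k = j then a else b)" for j a b
  have via: "compatible_via T MA X {j, next_index n j}" if "j \<in> {1..n}" for j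
    using that by (intro X) (auto simp: cycle_contexts_def)
  have X_meas: "X j \<in> measurements T (all_systems MA) \<and> outcomes T (X j) = {0, 1}"
    if "j \<in> {1..n}" for j
    using via[OF that] out[OF that] by (auto simp: compatible_via_def)
  have pair: "j \<noteq> next_index n j" "{j, next_index n j} \<subseteq> {1..agents MA}"
    "outcomes T (recorded MA j) = {0, 1}" "outcomes T (recorded MA (next_index n j)) = {0, 1}"
    if "j \<in> {1..n}" for j
    using next_index_neq[OF n that] next_index_in[OF that] that ag out by auto
  have e_pair: "e j a b = pair_prob T MA j (next_index n j) a b"
    if j: "j \<in> {1..n}" and "a \<in> {0, 1}" "b \<in> {0, 1}" for j a b
  proof -
    let ?C = "{j, next_index n j}"
    let ?a = "\<lambda>k. if k = j then a else b"
    \<comment> \<open>Compatibility speaks of extensional assignments; values outside the edge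
      affect neither side.\<close>
    have "restrict ?a ?C \<in> PiE ?C (\<lambda>k. outcomes T (recorded MA k))"
      using that pair[OF j] by auto
    then have "joint_prob T MA (default_settings ?C) (restrict ?a ?C)
        = apply_prob T \<rho> X ?C (restrict ?a ?C)"
      using via[OF j] unfolding compatible_via_def \<rho>_def by blast
    moreover have "joint_prob T MA (default_settings ?C) (restrict ?a ?C)
        = joint_prob T MA (default_settings ?C) ?a"
      by (rule joint_prob_cong) (auto simp: default_settings_def)
    moreover have "apply_prob T \<rho> X ?C (restrict ?a ?C) = apply_prob T \<rho> X ?C ?a"
      by (rule apply_prob_cong) auto
    ultimately show ?thesis
      by (simp add: e_def pair_prob_def)
  qed
  have single: "setup_prob T MA (default_settings {j, next_index n j}) [k \<mapsto> x] = prob T \<rho> [Measure (X k)] [x]"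
    if "j \<in> {1..n}" "k \<in> {j, next_index n j}" "x \<in> {0, 1}" for j k x
    using via[OF that(1)] pair[OF that(1)] that(2,3) unfolding compatible_via_def \<rho>_def by blast
  have fst: "(\<Sum>b\<in>{0, 1}. e j a b) = prob T \<rho> [Measure (X j)] [a]"
    if "j \<in> {1..n}" "a \<in> {0, 1}" for j a
    using setup_prob_pair_marginal(1)[OF pair[OF that(1)] that(2)] single[OF that(1) _ that(2)] that
    by (simp add: e_pair)
  have snd: "(\<Sum>a\<in>{0, 1}. e j a b) = prob T \<rho> [Measure (X (next_index n j))] [b]"
    if "j \<in> {1..n}" "b \<in> {0, 1}" for j b
    using setup_prob_pair_marginal(2)[OF pair[OF that(1)] that(2)] single[OF that(1) _ that(2)] that
    by (simp add: e_pair)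
  have \<rho>: "\<rho> \<in> states T (all_systems MA)"
    unfolding \<rho>_def by (rule initial_state(1)[OF MA])
  have poly: "e \<in> non_disturbance_polytope n"
    by (rule correlations_in_polytope[OF finite_all_systems[OF MA] \<rho> X_meas e_def fst snd])
  have zero: "e j x (1 - y) = 0"
    if j: "j \<in> {1..n}" and xy: "x \<in> {0, 1}" "y \<in> {0, 1}"
      and "knows T MA (cycle_contexts n) {} [A] (Inference [j \<mapsto> x] [next_index n j \<mapsto> y], None)"
    for j x y
  proof -
    \<comment> \<open>A quotient 1 excludes the denominator 0, as division by 0 gives 0; so
      numerator and denominator agree and the other summand vanishes.\<close>
    have "e j x y / (\<Sum>y\<in>{0, 1}. e j x y) = 1"
      using knows_Inference[OF that(4)] default_prediction_pair[OF pair[OF j] xy] j xy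
      by (simp add: e_pair)
    then show ?thesis
      using xy by auto
  qed
  \<comment> \<open>The first chain as values at the two ends of each edge: the index i is left with
    0 and reached with 1.\<close>
  define src where "src j = (if j = i then 0 else v j)" for j
  define tgt where "tgt j = (if next_index n j = i then 1 else v (next_index n j))" for j
  have src01: "src j \<in> {0, 1}" if "j \<in> {1..n}" for j
    using v[OF that] by (auto simp: src_def)
  have tgt01: "tgt j \<in> {0, 1}" if "j \<in> {1..n}" for j
    using v[OF next_index_in[OF that]] by (auto simp: tgt_def)
  have "extremal_vertex n e"
  proof (rule extremal_vertexI[OF poly i src01 tgt01])
    fix j
    assume j: "j \<in> {1..n}"
    have j': "next_index n j \<in> {1..n}"
      by (rule next_index_in[OF j])
    show "tgt j = src (next_index n j) + (if next_index n j = i then 1 else 0)"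
      by (simp add: src_def tgt_def)
    \<comment> \<open>Different bits are complementary, so the second chain runs through the
      complements of the first and yields the other zero of the edge j.\<close>
    have "(if j = i then 1 else v' j) = 1 - src j"
      using v[OF j] by (auto simp: src_def)
    moreover have "(if next_index n j = i then 0 else v' (next_index n j)) = 1 - tgt j"
      using v[OF j'] by (auto simp: tgt_def)
    ultimately have "knows T MA (cycle_contexts n) {} [A]
        (Inference [j \<mapsto> 1 - src j] [next_index n j \<mapsto> 1 - tgt j], None)"
      using bspec[OF chain(2)[unfolded inference_chain_def] j] by (simp only:)
    moreover have "1 - src j \<in> {0, 1}" "1 - tgt j \<in> {0, 1}"
      using src01[OF j] tgt01[OF j] by auto
    ultimately have "e j (1 - src j) (1 - (1 - tgt j)) = 0"
      by (intro zero[OF j])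
    moreover have "knows T MA (cycle_contexts n) {} [A]
        (Inference [j \<mapsto> src j] [next_index n j \<mapsto> tgt j], None)"
      using bspec[OF chain(1)[unfolded inference_chain_def] j] by (simp only: src_def tgt_def)
    then have "e j (src j) (1 - tgt j) = 0"
      by (rule zero[OF j src01[OF j] tgt01[OF j]])
    ultimately show "e j (src j) (1 - tgt j) = 0 \<and> e j (1 - src j) (tgt j) = 0"
      using tgt01[OF j] by auto
  qed
  moreover have "admits_correlations T n e"
    unfolding admits_correlations_def
  proof (intro exI[of _ "all_systems MA"] exI[of _ \<rho>] exI[of _ X] conjI ballI)
    show "jointly_measurable T (all_systems MA) X {j, next_index n j}" if "j \<in> {1..n}" for j
      using via[OF that] by (simp add: compatible_via_def)
  qed (use finite_all_systems[OF MA] \<rho> X_meas e_def fst snd in simp_all)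
  ultimately show ?thesis
    unfolding contains_extremal_vertex_def by blast
qed


section \<open>From vertices to paradoxes\<close>

text \<open>\<open>memory_supply\<close> avoids any given finite set; adding the memories already
  chosen to that set makes the choice injective.\<close>

lemma distinct_memories:
  assumes "finite U" "finite I" "\<And>i. i \<in> I \<Longrightarrow> m i \<in> measurements T U"
  shows "\<exists>L. inj_on L I \<and> (\<forall>i\<in>I. L i \<notin> U \<and> can_store T (m i) (L i) \<and> states T {L i} \<noteq> {})"
  using assms(2,3)
proof (induction I rule: finite_induct)
  case (insert i I)
  then obtain L where L: "inj_on L I"
    "\<forall>i\<in>I. L i \<notin> U \<and> can_store T (m i) (L i) \<and> states T {L i} \<noteq> {}"
    by blast
  obtain l where l: "l \<notin> U \<union> L ` I" "can_store T (m i) l" "states T {l} \<noteq> {}"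
    using memory_supply[OF assms(1), of "U \<union> L ` I" "m i"] assms(1) insert by auto
  have "inj_on (L(i := l)) (insert i I)"
    using L(1) l(1) insert(2) by (auto simp: inj_on_def)
  moreover have "\<forall>j\<in>insert i I. (L(i := l)) j \<notin> U \<and> can_store T (m j) ((L(i := l)) j) \<and>
      states T {(L(i := l)) j} \<noteq> {}"
    using L(2) l by simp
  ultimately show ?case
    by blast
qed simp

text \<open>The joint measurement may depend on the state. For a state of the larger systems, the
  one belonging to its reduction to \<open>U\<close> works, since measurements on \<open>U\<close>
  cannot tell the two states apart.\<close>

lemma jointly_measurable_mono:
  assumes "finite V" "U \<subseteq> V" "jointly_measurable T U X I"
  shows "jointly_measurable T V X I"
  unfolding jointly_measurable_def
proof (intro conjI ballI)
  have sub: "measurements T U \<subseteq> measurements T V"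
    by (rule extend_measurement[OF assms(1,2)])
  have X: "\<And>i. i \<in> I \<Longrightarrow> X i \<in> measurements T U"
    using assms(3) by (simp add: jointly_measurable_def)
  show "X i \<in> measurements T V" if "i \<in> I" for i
    using X[OF that] sub by blast
  fix \<rho>
  assume \<rho>: "\<rho> \<in> states T V"
  have red: "prob T (reduce T \<rho> U) [Measure m] = prob T \<rho> [Measure m]" if "m \<in> measurements T U" for m
    using that by (intro reduce_prob[OF assms(1) \<rho> assms(2)]) simp
  obtain J f where J: "J \<in> measurements T U"
    and f: "bij_betw f (outcomes T J) (PiE I (\<lambda>i. outcomes T (X i)))"
    and marg: "\<forall>i\<in>I. \<forall>x\<in>outcomes T (X i).
      (\<Sum>y | y \<in> outcomes T J \<and> f y i = x. prob T (reduce T \<rho> U) [Measure J] [y])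
        = prob T (reduce T \<rho> U) [Measure (X i)] [x]"
    using assms(3) reduce_state[OF assms(1) \<rho> assms(2)] unfolding jointly_measurable_def by blast
  have "\<forall>i\<in>I. \<forall>x\<in>outcomes T (X i).
      (\<Sum>y | y \<in> outcomes T J \<and> f y i = x. prob T \<rho> [Measure J] [y]) = prob T \<rho> [Measure (X i)] [x]"
    using marg X by (simp add: red J)
  then show "\<exists>J\<in>measurements T V. \<exists>f. bij_betw f (outcomes T J) (PiE I (\<lambda>i. outcomes T (X i))) \<and>
      (\<forall>i\<in>I. \<forall>x\<in>outcomes T (X i).
        (\<Sum>y | y \<in> outcomes T J \<and> f y i = x. prob T \<rho> [Measure J] [y]) = prob T \<rho> [Measure (X i)] [x])"
    using J f sub by blast
qed

text \<open>The operations are simplified from the front: a record becomes a bare measurement, an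
  identity disappears. \<open>pre\<close> collects the measurements already obtained; they act on
  \<open>U\<close> and thus not on the memory of the next record.\<close>

lemma prob_records:
  assumes V: "finite V" "\<rho> \<in> states T V" and inj: "inj_on L (set is)" "distinct is"
    and U: "U \<subseteq> V" "L ` set is \<subseteq> V - U" "\<And>i. i \<in> set is \<Longrightarrow> X i \<in> measurements T U"
    and store: "\<And>i. i \<in> set is \<Longrightarrow> can_store T (X i) (L i)"
    and pre: "\<forall>x\<in>set pre. acts_on T U x"
  shows "prob T \<rho> (pre @ map (\<lambda>i. if s i then Record (X i) (L i)
        else Evolve (ident T (insert (L i) U))) is)
    = prob T \<rho> (pre @ map (\<lambda>i. Measure (X i)) (filter s is))"
  using inj U(2,3) store pre
proof (induction "is" arbitrary: pre)
  case (Cons i "is")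
  let ?op = "\<lambda>i. if s i then Record (X i) (L i) else Evolve (ident T (insert (L i) U))"
  have Li: "L i \<in> V" "L i \<notin> U" "L i \<notin> L ` set is"
    using Cons.prems by auto
  have fin: "finite W" if "W \<subseteq> V" for W
    using that V(1) by (rule finite_subset)
  have op: "acts_on T W (?op j)" if "insert (L j) U \<subseteq> W" "W \<subseteq> V" "j \<in> set (i # is)" for j W
  proof -
    have "X j \<in> measurements T (W - {L j})"
      using that Cons.prems(3,4) by (intro subsetD[OF extend_measurement[of "W - {L j}" U]]) (auto intro: fin)
    moreover have "ident T (insert (L j) U) \<in> transformations T W"
      using that fin
      by (intro subsetD[OF extend_transformation[of W "insert (L j) U"]] ident_transformation) auto
    ultimately show ?thesis
      using that Cons.prems(5) by auto
  qed
  have pre: "\<forall>x\<in>set pre. acts_on T W x" if "U \<subseteq> W" "W \<subseteq> V" for W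
    using Cons.prems(6) acts_on_mono that fin by blast
  \<comment> \<open>As the memories are distinct, the later operations stay away from
    \<open>L i\<close>, which \<open>record_statistics\<close> requires.\<close>
  have "acts_on T (V - {L i}) (?op j)" if "j \<in> set is" for j
  proof (rule op)
    have "L j \<noteq> L i"
      using that Li(3) by (metis imageI)
    then show "insert (L j) U \<subseteq> V - {L i}"
      using that Li Cons.prems(3) U(1) by auto
  qed (use that in auto)
  moreover have "\<forall>x\<in>set pre. acts_on T (V - {L i}) x"
    using Li U(1) by (intro pre) auto
  ultimately have rest: "\<forall>x\<in>set (pre @ map ?op is). acts_on T (V - {L i}) x"
    unfolding set_append set_map by blast
  have IH: "prob T \<rho> (pre' @ map ?op is) = prob T \<rho> (pre' @ map (\<lambda>i. Measure (X i)) (filter s is))"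
    if "\<forall>x\<in>set pre'. acts_on T U x" for pre'
    using that Cons.prems by (intro Cons.IH) auto
  show ?case
  proof (cases "s i")
    case True
    then have "acts_on T V (Record (X i) (L i))"
      using op[of i V] Cons.prems(3) U(1) by auto
    from record_statistics[OF V this rest]
    have "prob T \<rho> (pre @ map ?op (i # is)) = prob T \<rho> ((pre @ [Measure (X i)]) @ map ?op is)"
      using True by simp
    also have "\<dots> = prob T \<rho> ((pre @ [Measure (X i)]) @ map (\<lambda>i. Measure (X i)) (filter s is))"
      using Cons.prems by (intro IH) auto
    finally show ?thesis
      using True by simp
  next
    case False
    have "\<forall>x\<in>set (pre @ map ?op is). acts_on T V x"
      using rest acts_on_mono[OF V(1), of "V - {L i}"] by blast
    then have "prob T \<rho> (pre @ Evolve (ident T (insert (L i) U)) # map ?op is)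
        = prob T \<rho> (pre @ map ?op is)"
      using Li U(1) by (intro ident_trivial[OF V]) auto
    then show ?thesis
      using False IH[OF Cons.prems(6)] by simp
  qed
qed simp

text \<open>Every agent measures on all of \<open>U\<close>, writes into a memory of its own and
  does the identity under the setting 0. Hence the agents with setting 0 leave no trace in a default
  prediction.\<close>

lemma idle_setup:
  assumes U: "finite U" "\<rho> \<in> states T U" and X: "\<And>i. i \<in> {1..n} \<Longrightarrow> X i \<in> measurements T U"
  obtains MA where "agents MA = n" "recorded MA = X" "multi_agent_setup T MA"
    "U \<subseteq> all_systems MA"
    "\<And>C a. C \<subseteq> {1..n} \<Longrightarrow> joint_prob T MA (default_settings C) a = apply_prob T \<rho> X C a"
    "\<And>C a. C \<subseteq> {1..n} \<Longrightarrow> apply_prob T (initial_state T MA) X C a = apply_prob T \<rho> X C a"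
    "\<And>m. m \<in> measurements T U \<Longrightarrow> prob T (initial_state T MA) [Measure m] = prob T \<rho> [Measure m]"
proof -
  obtain L where L: "inj_on L {1..n}"
    "\<forall>i\<in>{1..n}. L i \<notin> U \<and> can_store T (X i) (L i) \<and> states T {L i} \<noteq> {}"
    using distinct_memories[OF U(1), of "{1..n}" X] X by auto
  define \<sigma> where "\<sigma> i = (SOME \<tau>. \<tau> \<in> states T {L i})" for i
  have \<sigma>: "\<sigma> i \<in> states T {L i}" if "i \<in> {1..n}" for i
    unfolding \<sigma>_def using L(2) that by (simp add: some_in_eq)
  define MA where "MA = \<lparr>agents = n, systems = U, initial = \<rho>, lab = L, lab_state = \<sigma>,
    measured = (\<lambda>_. U), recorded = X, evolution = (\<lambda>i. ident T (insert (L i) U))\<rparr>"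
  have simps: "agents MA = n" "systems MA = U" "initial MA = \<rho>" "lab MA = L" "lab_state MA = \<sigma>"
    "measured MA = (\<lambda>_. U)" "recorded MA = X" "evolution MA = (\<lambda>i. ident T (insert (L i) U))"
    by (simp_all add: MA_def)
  have all: "all_systems MA = U \<union> L ` {1..n}"
    by (simp add: all_systems_def simps)
  have valid: "multi_agent_setup T MA"
    unfolding multi_agent_setup_def all simps using U X L \<sigma>
    by (auto intro!: ident_transformation)
  have red: "prob T (initial_state T MA) ops = prob T \<rho> ops" if "\<forall>x\<in>set ops. acts_on T U x" for ops
    using initial_state(2)[OF valid] that by (simp add: simps)
  have appl: "apply_prob T (initial_state T MA) X C a = apply_prob T \<rho> X C a" if "C \<subseteq> {1..n}" for C a
    unfolding apply_prob_def
    using that X finite_subset[OF that] by (subst red) auto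
  have joint: "joint_prob T MA (default_settings C) a = apply_prob T \<rho> X C a" if C: "C \<subseteq> {1..n}" for C a
  proof -
    have finC: "finite C"
      using C by (rule finite_subset) simp
    \<comment> \<open>Times and indices increase together, so the agents of \<open>C\<close> act in
      the order in which \<open>apply_prob\<close> lists their measurements.\<close>
    have list: "filter (\<lambda>i. i \<in> C) [1..<Suc n] = sorted_list_of_set C"
      using C finC by (intro sorted_distinct_set_unique) (auto simp del: upt_Suc intro: sorted_wrt_filter)
    have "prob T (initial_state T MA) ([] @ map (\<lambda>i. if default_settings C i then Record (X i) (L i)
          else Evolve (ident T (insert (L i) U))) [1..<Suc n])
        = prob T (initial_state T MA)
            ([] @ map (\<lambda>i. Measure (X i)) (filter (default_settings C) [1..<Suc n]))"
    proof (rule prob_records[where U = U])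
      have "set [1..<Suc n] = {1..n}"
        by auto
      then show "inj_on L (set [1..<Suc n])" "L ` set [1..<Suc n] \<subseteq> all_systems MA - U"
        "\<And>i. i \<in> set [1..<Suc n] \<Longrightarrow> X i \<in> measurements T U"
        "\<And>i. i \<in> set [1..<Suc n] \<Longrightarrow> can_store T (X i) (L i)"
        using L X by (auto simp: all simp del: upt_Suc)
    qed (use finite_all_systems[OF valid] initial_state(1)[OF valid] all in \<open>auto simp del: upt_Suc\<close>)
    then have "joint_prob T MA (default_settings C) a = apply_prob T (initial_state T MA) X C a"
      unfolding joint_prob_def scenario_def apply_prob_def simps default_settings_def list by simp
    then show ?thesis
      using appl[OF C] by simp
  qed
  show thesis
    by (rule that[of MA]) (use simps valid all joint appl red in auto)
qed

text \<open>The measurements \<open>X\<close> themselves serve as the primed ones in every context.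
  Beyond the two chains, a contradiction in some run has to be exhibited: an observed x_1 = 0 is
  followed along the first chain to x_1 = 1.\<close>

lemma vertex_imp_paradox:
  assumes n: "2 \<le> n" and vertex: "contains_extremal_vertex T n"
  shows "admits_post_selection_free_cycle_paradox T n"
proof -
  obtain e where adm: "admits_correlations T n e" and ext: "extremal_vertex n e"
    using vertex by (auto simp: contains_extremal_vertex_def)
  obtain U \<rho> X where U: "finite U" "\<rho> \<in> states T U"
    and X: "\<forall>i\<in>{1..n}. X i \<in> measurements T U \<and> outcomes T (X i) = {0, 1}"
    and corr: "\<forall>i\<in>{1..n}.
      jointly_measurable T U X {i, next_index n i} \<and>
      (\<forall>a\<in>{0, 1}. \<forall>b\<in>{0, 1}.
         e i a b = apply_prob T \<rho> X {i, next_index n i} (\<lambda>j. if j = i then a else b)) \<and>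
      (\<forall>a\<in>{0, 1}. (\<Sum>b\<in>{0, 1}. e i a b) = prob T \<rho> [Measure (X i)] [a]) \<and>
      (\<forall>b\<in>{0, 1}. (\<Sum>a\<in>{0, 1}. e i a b) = prob T \<rho> [Measure (X (next_index n i))] [b])"
    using adm unfolding admits_correlations_def by (elim exE conjE) (rule that)
  note X = bspec[OF X]
  have joint: "jointly_measurable T U X {i, next_index n i}"
    and e: "a \<in> {0, 1} \<Longrightarrow> b \<in> {0, 1} \<Longrightarrow>
      e i a b = apply_prob T \<rho> X {i, next_index n i} (\<lambda>j. if j = i then a else b)"
    and fst: "a \<in> {0, 1} \<Longrightarrow> (\<Sum>b\<in>{0, 1}. e i a b) = prob T \<rho> [Measure (X i)] [a]"
    and snd: "b \<in> {0, 1} \<Longrightarrow>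
      (\<Sum>a\<in>{0, 1}. e i a b) = prob T \<rho> [Measure (X (next_index n i))] [b]"
    if "i \<in> {1..n}" for i a b
    using bspec[OF corr that] by blast+
  have X_meas: "\<And>i. i \<in> {1..n} \<Longrightarrow> X i \<in> measurements T U"
    using X by blast
  obtain MA where ag: "agents MA = n" and rec: "recorded MA = X" and valid: "multi_agent_setup T MA"
    and sub: "U \<subseteq> all_systems MA"
    and jp: "\<And>C a. C \<subseteq> {1..n} \<Longrightarrow> joint_prob T MA (default_settings C) a = apply_prob T \<rho> X C a"
    and ap: "\<And>C a. C \<subseteq> {1..n} \<Longrightarrow> apply_prob T (initial_state T MA) X C a = apply_prob T \<rho> X C a"
    and mp: "\<And>m. m \<in> measurements T U \<Longrightarrow>
      prob T (initial_state T MA) [Measure m] = prob T \<rho> [Measure m]"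
    by (rule idle_setup[where n = n and X = X, OF U X_meas]) (assumption, rule that)
  obtain src tgt where src1: "src 1 = 0" and src01: "\<And>j. j \<in> {1..n} \<Longrightarrow> src j \<in> {0, 1}"
    and tgt: "\<And>j. tgt j = (if next_index n j = 1 then 1 else src (next_index n j))"
    and val: "\<And>j. j \<in> {1..n} \<Longrightarrow> e j (src j) (tgt j) = 1/2 \<and> e j (1 - src j) (1 - tgt j) = 1/2 \<and>
       e j (src j) (1 - tgt j) = 0 \<and> e j (1 - src j) (tgt j) = 0"
    by (rule extremal_vertexE[OF ext]) (use n in simp, rule that)
  have tgt01: "tgt j \<in> {0, 1}" if "j \<in> {1..n}" for j
    using src01[OF next_index_in[OF that]] by (simp add: tgt)
  have pair: "j \<noteq> next_index n j" "{j, next_index n j} \<subseteq> {1..agents MA}"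
    "outcomes T (recorded MA j) = {0, 1}" "outcomes T (recorded MA (next_index n j)) = {0, 1}"
    if "j \<in> {1..n}" for j
    using next_index_neq[OF n that] next_index_in[OF that] that ag rec X by auto
  have e_pair: "pair_prob T MA j (next_index n j) a b = e j a b"
    if "j \<in> {1..n}" "a \<in> {0, 1}" "b \<in> {0, 1}" for j a b
    unfolding pair_prob_def using pair(2)[OF that(1)] e[OF that] ag by (simp add: jp)
  have via: "compatible_via T MA X C" if context_C: "C \<in> cycle_contexts n" for C
  proof -
    obtain j where j: "j \<in> {1..n}" and C: "C = {j, next_index n j}"
      using context_C unfolding cycle_contexts_def by blast
    have finV: "finite (all_systems MA)"
      by (rule finite_all_systems[OF valid])
    have CI: "C \<subseteq> {1..n}"
      using pair(2)[OF j] ag C by simp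
    have marg: "setup_prob T MA (default_settings C) [k \<mapsto> x]
        = prob T (initial_state T MA) [Measure (X k)] [x]"
      if "k \<in> C" "x \<in> outcomes T (recorded MA k)" for k x
    proof -
      have k: "k \<in> {1..n}" and x: "x \<in> {0, 1}"
        using that CI rec X by blast+
      have "setup_prob T MA (default_settings C) [k \<mapsto> x] = prob T \<rho> [Measure (X k)] [x]"
      proof (cases "k = j")
        case True
        have "setup_prob T MA (default_settings C) [j \<mapsto> x] = (\<Sum>b\<in>{0, 1}. e j x b)"
          unfolding C setup_prob_pair_marginal(1)[OF pair[OF j] x]
          by (intro sum.cong refl e_pair[OF j x])
        then show ?thesis
          using True fst[OF j x] by simp
      next
        case False
        then have "k = next_index n j"
          using that(1) C by simp
        moreover have "setup_prob T MA (default_settings C) [next_index n j \<mapsto> x] = (\<Sum>a\<in>{0, 1}. e j a x)"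
          unfolding C setup_prob_pair_marginal(2)[OF pair[OF j] x]
          by (intro sum.cong refl e_pair[OF j _ x])
        ultimately show ?thesis
          using snd[OF j x] by simp
      qed
      then show ?thesis
        using mp[OF X_meas[OF k]] by simp
    qed
    show ?thesis
      unfolding compatible_via_def
    proof (intro conjI ballI)
      show "C \<subseteq> {1..agents MA}"
        using CI ag by simp
      show "X k \<in> measurements T (all_systems MA)" if "k \<in> C" for k
        using X_meas extend_measurement[OF finV sub] that CI by blast
      show "joint_prob T MA (default_settings C) a = apply_prob T (initial_state T MA) X C a" for a
        using jp[OF CI] ap[OF CI] by simp
      show "jointly_measurable T (all_systems MA) X C"
        unfolding C by (rule jointly_measurable_mono[OF finV sub joint[OF j]])
    qed (simp_all add: rec marg)
  qed
  have stmt: "(Inference [j \<mapsto> x] [next_index n j \<mapsto> y],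
      default_settings ({next_index n j} \<union> {j})) \<in> setup_statements T MA"
    if j: "j \<in> {1..n}" and xy: "x \<in> {0, 1}" "y \<in> {0, 1}" and "e j x y = 1/2" "e j x (1 - y) = 0" for j x y
  proof -
    have "default_prediction T MA [next_index n j \<mapsto> y] [j \<mapsto> x] = 1"
      unfolding default_prediction_pair[OF pair[OF j] xy]
      using that by (auto simp: e_pair)
    then have "(Inference [j \<mapsto> x] [next_index n j \<mapsto> y],
        default_settings (dom [next_index n j \<mapsto> y] \<union> dom [j \<mapsto> x])) \<in> setup_statements T MA"
      using pair(1,2)[OF j] unfolding setup_statements_def by (intro UnI2 CollectI exI conjI refl) auto
    then show ?thesis
      by simp
  qed
  \<comment> \<open>\<open>E\<close> is arbitrary because the inferences are used twice: without
    observations in the two chains, and with one observation in the contradiction.\<close>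
  have infer: "knows T MA (cycle_contexts n) E [1] (Inference [j \<mapsto> x] [next_index n j \<mapsto> y], None)"
    if j: "j \<in> {1..n}" and "x \<in> {0, 1}" "y \<in> {0, 1}" "e j x y = 1/2" "e j x (1 - y) = 0" for j x y E
  proof (rule knows.setting_independence)
    show "knows T MA (cycle_contexts n) E [1] (Inference [j \<mapsto> x] [next_index n j \<mapsto> y],
        Some (default_settings ({next_index n j} \<union> {j})))"
      by (rule knows.common_knowledge[OF stmt[OF that], of "{j, next_index n j}"])
        (use j n ag in \<open>auto simp: cycle_contexts_def\<close>)
  qed
  have chain1: "knows T MA (cycle_contexts n) E [1] (Inference [j \<mapsto> src j] [next_index n j \<mapsto> tgt j], None)"
    and chain2: "knows T MA (cycle_contexts n) E [1]
      (Inference [j \<mapsto> 1 - src j] [next_index n j \<mapsto> 1 - tgt j], None)"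
    if "j \<in> {1..n}" for j E
    using src01[OF that] tgt01[OF that] val[OF that] by (intro infer[OF that]; auto)+
  have one: "(1::nat) \<in> {1..n}"
    using n by simp
  define s where "s = default_settings (dom [1 \<mapsto> 0 :: nat])"
  have obs: "(Outcome [1 \<mapsto> 0], s) \<in> setup_statements T MA"
  proof -
    \<comment> \<open>Each row of \<open>e 1\<close> contains 1/2 once and 0 once, and its sum is
      the marginal of x_1.\<close>
    have marg: "prob T \<rho> [Measure (X 1)] [a] = 1/2" if "a \<in> {0, 1}" for a
      using fst[OF one that] val[OF one] tgt01[OF one] src1 that by auto
    have out: "outcomes T (recorded MA 1) = {0, 1}" and ag1: "1 \<in> {1..agents MA}"
      using X[OF one] rec one ag by simp_all
    have half: "joint_prob T MA (default_settings {1}) (\<lambda>_. x) = 1/2" if "x \<in> {0, 1}" for x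
      using jp[of "{1}" "\<lambda>_. x"] one marg[OF that] by (simp add: apply_prob_def)
    have fin: "finite (outcomes T (recorded MA 1))"
      unfolding out by simp
    have single: "setup_prob T MA (default_settings {1}) v =
        (\<Sum>x\<in>{0, 1}. if v 1 = None \<or> v 1 = Some x then 1/2 else 0)" if "dom v \<subseteq> {1}" for v
      unfolding setup_prob_single[OF ag1 that fin] out
      by (intro sum.cong refl if_cong half)
    have "setup_prob T MA (default_settings {1}) Map.empty = 1"
      by (subst single) simp_all
    moreover have "setup_prob T MA (default_settings {1}) [1 \<mapsto> 0] = 1/2"
      by (subst single) simp_all
    ultimately have "default_prediction T MA [1 \<mapsto> 0] Map.empty > 0"
      by (simp add: default_prediction_def Let_def)
    then show ?thesis
      unfolding s_def setup_statements_def using one ag by (intro UnI1 CollectI exI conjI refl) auto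
  qed
  let ?E = "{(1, Outcome [1 \<mapsto> 0], s)}"
  let ?knows = "knows T MA (cycle_contexts n) ?E [1]"
  have start: "?knows (Outcome [1 \<mapsto> 0], None)"
  proof (rule knows.setting_independence)
    show "?knows (Outcome [1 \<mapsto> 0], Some s)"
      using knows.observation[OF obs, of "{1, next_index n 1}" _ 1 ?E "[]"] one ag
      by (auto simp: cycle_contexts_def)
  qed
  \<comment> \<open>Agent 1 reaches the outcome at index \<open>Suc k\<close> after k links of the
    first chain. The closing link is taken separately, since there the index returns to 1 and
    \<open>tgt\<close> is 1.\<close>
  have walk: "?knows (Outcome [Suc k \<mapsto> src (Suc k)], None)" if "k < n" for k
    using that
  proof (induction k)
    case 0
    then show ?case
      using start src1 by (simp only: One_nat_def)
  next
    case (Suc k)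
    have "?knows (Outcome [Suc k \<mapsto> src (Suc k)], None)"
      by (rule Suc.IH) (use Suc.prems in simp)
    then have "?knows (Outcome [next_index n (Suc k) \<mapsto> tgt (Suc k)], None)"
      by (rule knows.distribution[OF disjI2 chain1]) (use Suc.prems in simp)
    moreover have "next_index n (Suc k) = Suc (Suc k)"
      using Suc.prems by (simp add: next_index_eq)
    moreover from this have "tgt (Suc k) = src (Suc (Suc k))"
      by (simp add: tgt)
    ultimately show ?case
      by (simp only:)
  qed
  have "n - 1 < n" "Suc (n - 1) = n"
    using n by simp_all
  then have "?knows (Outcome [n \<mapsto> src n], None)"
    using walk[of "n - 1"] by (simp only:)
  then have "?knows (Outcome [next_index n n \<mapsto> tgt n], None)"
    by (rule knows.distribution[OF disjI2 chain1]) (use n in simp)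
  moreover have "next_index n n = 1" "tgt n = 1"
    using n by (simp_all add: tgt next_index_eq)
  ultimately have "?knows (Outcome [1 \<mapsto> 1], None)"
    by (simp only:)
  \<comment> \<open>Both assignments concern x_1 alone, so knowing x_1 = 1 includes the negation of
    the observed x_1 = 0.\<close>
  then have "?knows (Negated [1 \<mapsto> 0], None)"
    by (rule knows.negation) (auto simp: fun_eq_iff)
  then have "\<not> non_contradictory_outcomes T MA (cycle_contexts n) ?E"
    unfolding non_contradictory_outcomes_def using start one ag by blast
  then have "multi_agent_paradox T MA (cycle_contexts n)"
    unfolding multi_agent_paradox_def compatibility_structure_def using valid via obs by blast
  moreover have "inference_chain T MA n 1 1 0 src 1"
    unfolding inference_chain_def
  proof
    fix j
    assume "j \<in> {1..n}"
    moreover have "(if j = 1 then 0 else src j) = src j"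
      using src1 by auto
    ultimately show "knows T MA (cycle_contexts n) {} [1]
        (Inference [j \<mapsto> (if j = 1 then 0 else src j)]
          [next_index n j \<mapsto> (if next_index n j = 1 then 1 else src (next_index n j))], None)"
      using chain1[of j "{}"] by (simp only: tgt)
  qed
  \<comment> \<open>The second chain is the complement of the first; the weight 1/2 on the
    complementary pairs makes its links inferences as well.\<close>
  moreover have "inference_chain T MA n 1 1 1 (\<lambda>j. 1 - src j) 0"
    unfolding inference_chain_def
  proof
    fix j
    assume "j \<in> {1..n}"
    moreover have "(if j = 1 then 1 else 1 - src j) = 1 - src j"
      using src1 by auto
    moreover have "(if next_index n j = 1 then 0 else 1 - src (next_index n j)) = 1 - tgt j"
      by (simp add: tgt)
    ultimately show "knows T MA (cycle_contexts n) {} [1]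
        (Inference [j \<mapsto> (if j = 1 then 1 else 1 - src j)]
          [next_index n j \<mapsto> (if next_index n j = 1 then 0 else 1 - src (next_index n j))], None)"
      using chain2[of j "{}"] by (simp only:)
  qed
  moreover have "\<forall>j\<in>{1..n} - {1}. src j \<in> {0, 1} \<and> 1 - src j \<in> {0, 1} \<and> src j \<noteq> 1 - src j"
    using src01 by fastforce
  ultimately have "post_selection_free_cycle_paradox T n MA"
    unfolding post_selection_free_cycle_paradox_def rec
    by (intro conjI ballI bexI[of _ 1] exI[of _ src] exI[of _ "\<lambda>j. 1 - src j"] one ag
        conjunct2[OF X]) blast+
  then show ?thesis
    unfolding admits_post_selection_free_cycle_paradox_def by blast
qed

end

theorem theorem5:
  fixes T :: "('s, 'r, 't, 'm) phys_theory" and n :: nat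
  assumes "physical_theory T" and "n \<ge> 3"
  shows "admits_post_selection_free_cycle_paradox T n \<longleftrightarrow> contains_extremal_vertex T n"
proof -
  interpret physical_theory T
    by fact
  show ?thesis
    using assms(2) paradox_imp_vertex[of n] vertex_imp_paradox[of n]
    by (auto simp: admits_post_selection_free_cycle_paradox_def)
qed

end
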